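(* Let $\mu$ be a Borel probability measure on $[0,1)^2$ that is singular with respect to Lebesgue measure, and let $S\subseteq[0,1]^2$ be a compact set on which $\mu$ is supported. Let the $x$-marginal measure $\mu_1$ of $\mu$ be singular, and suppose that there exist constants $C$ and $\alpha$ such that $\mu_1(I)\leq C|I|^\alpha$ for all intervals $I\subseteq[0,1]$. Suppose also that $\dim_H(S)<\alpha+1$. Let $\mu(dx\,dy)=\rho_x(dy)\,\mu_1(dx)$ be the Rokhlin disintegration of $\mu$. Then $\rho_x$ is singular for $\mu_1$-almost every $x$, and every $f\in L^2(\mu)$ can be written as $$f(x,y)=\sum_{n=0}^{\infty}\sum_{m=0}^{\infty}d_{nm}e^{2\pi i(ny+mx)}$$ for some $d_{nm}\in\mathbb{C}$ depending on $f$, with conditional convergence in the norm of $L^2(\mu)$.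
   Context: "Singular" means singular with respect to Lebesgue measure of the appropriate dimension. $\mu$ is supported on $S$ means $S$ is measurable and $\mu(S^{\mathcal C})=0$. $\dim_H$ is Hausdorff dimension; $|I|$ is the length of $I$ (with the convention $|I|^0=1$). The $x$-marginal is $\mu_1=\mu\circ\pi_x^{-1}$, $\pi_x(x,y)=x$, regarded as a measure on $[0,1]$ when needed. Rokhlin disintegration: there is a $\mu_1$-almost-everywhere unique family $\{\rho_x\}$ of Borel probability measures on $[0,1)$ (slice measures) such that $\int f\,d\mu=\int\int f(x,y)\,\rho_x(dy)\,\mu_1(dx)$ for every $f\in L^1(\mu)$. Conditional convergence in norm: the double sum is an iterated sum (for each $n$ the inner sum over $m$ converges in $L^2(\mu)$, and then the outer sum over $n$ converges in $L^2(\mu)$); unconditional convergence is not claimed. *)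

theory Defs
  imports "HOL-Probability.Probability"
begin

definition supported_on :: "'a measure \<Rightarrow> 'a set \<Rightarrow> bool" where
  "supported_on M S \<longleftrightarrow> S \<in> sets M \<and> emeasure M (space M - S) = 0"

definition singular_wrt :: "'a measure \<Rightarrow> 'a measure \<Rightarrow> bool" where
  "singular_wrt M N \<longleftrightarrow> sets M = sets N \<and> (\<exists>A\<in>sets M. emeasure N A = 0 \<and> supported_on M A)"

text \<open>
  The power \<open>t\<^sup>s\<close> of a length \<open>t \<ge> 0\<close>, with values in \<open>[0, \<infinity>]\<close>. Unlike \<^const>\<open>powr\<close>, which
  vanishes at base \<open>0\<close>, it satisfies \<open>0\<^sup>0 = 1\<close>, and \<open>0\<^sup>s = \<infinity>\<close> for \<open>s < 0\<close>.
\<close>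

definition length_power :: "real \<Rightarrow> real \<Rightarrow> ennreal" where
  "length_power t s =
     (if t = 0 then (if s = 0 then 1 else if s > 0 then 0 else \<infinity>) else ennreal (t powr s))"

text \<open>
  The boundedness condition is needed because \<^const>\<open>diameter\<close> is unspecified on unbounded sets;
  empty sets in a cover contribute nothing, also for \<open>s = 0\<close>, so that finite covers are included.
\<close>

definition hausdorff_premeasure :: "real \<Rightarrow> real \<Rightarrow> 'a::metric_space set \<Rightarrow> ennreal" where
  "hausdorff_premeasure \<delta> s A =
     (INF U \<in> {U :: nat \<Rightarrow> 'a set. A \<subseteq> (\<Union>i. U i) \<and> (\<forall>i. bounded (U i) \<and> diameter (U i) \<le> \<delta>)}.
        \<Sum>i. if U i = {} then 0 else length_power (diameter (U i)) s)"

definition hausdorff_measure :: "real \<Rightarrow> 'a::metric_space set \<Rightarrow> ennreal" where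
  "hausdorff_measure s A = (SUP \<delta>\<in>{0<..}. hausdorff_premeasure \<delta> s A)"

definition hausdorff_dim :: "'a::metric_space set \<Rightarrow> ereal" where
  "hausdorff_dim A = (INF s\<in>{s. 0 \<le> s \<and> hausdorff_measure s A = 0}. ereal s)"

definition x_marginal :: "(real \<times> real) measure \<Rightarrow> real measure" where
  "x_marginal \<mu> = distr \<mu> borel fst"

text \<open>
  The integrability clauses make the iterated integral meaningful, since the Bochner integral of
  a non-integrable function is \<open>0\<close>. The values of \<open>\<rho>\<close> outside \<open>[0,1)\<close> are irrelevant.
\<close>

definition rokhlin_disintegration ::
    "(real \<times> real) measure \<Rightarrow> (real \<Rightarrow> real measure) \<Rightarrow> bool" where
  "rokhlin_disintegration \<mu> \<rho> \<longleftrightarrow>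
     (\<forall>x\<in>{0..<1}. prob_space (\<rho> x) \<and> sets (\<rho> x) = sets borel \<and> supported_on (\<rho> x) {0..<1}) \<and>
     (\<forall>f :: real \<times> real \<Rightarrow> complex. integrable \<mu> f \<longrightarrow>
        (AE x in x_marginal \<mu>. integrable (\<rho> x) (\<lambda>y. f (x, y))) \<and>
        set_integrable (x_marginal \<mu>) {0..<1} (\<lambda>x. LINT y|\<rho> x. f (x, y)) \<and>
        (LINT z|\<mu>. f z) = (LINT x:{0..<1}|x_marginal \<mu>. (LINT y|\<rho> x. f (x, y))))"

definition L2 :: "'a measure \<Rightarrow> ('a \<Rightarrow> complex) set" where
  "L2 M = {f \<in> borel_measurable M. integrable M (\<lambda>z. (cmod (f z))\<^sup>2)}"

definition L2_norm :: "'a measure \<Rightarrow> ('a \<Rightarrow> complex) \<Rightarrow> real" where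
  "L2_norm M f = sqrt (LINT z|M. (cmod (f z))\<^sup>2)"

definition L2_sums :: "'a measure \<Rightarrow> (nat \<Rightarrow> 'a \<Rightarrow> complex) \<Rightarrow> ('a \<Rightarrow> complex) \<Rightarrow> bool" where
  "L2_sums M u f \<longleftrightarrow> (\<forall>k. u k \<in> L2 M) \<and> f \<in> L2 M \<and>
     (\<lambda>N. L2_norm M (\<lambda>z. (\<Sum>k<N. u k z) - f z)) \<longlonglongrightarrow> 0"

end

theory Submission
  imports Defs
begin

text \<open>
  The product \<open>\<mu>\<^sub>1 \<times> Lebesgue\<close> gives a set of diameter \<open>t\<close> mass at most \<open>C t\<^sup>\<alpha> t\<close>, so it vanishes
  on \<open>S\<close> because \<open>dim\<^sub>H S < \<alpha> + 1\<close>; by Fubini almost every slice of \<open>S\<close>, which carries \<open>\<rho>\<^sub>x\<close>, is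
  Lebesgue null.

  In \<open>L\<^sup>2\<close> of a singular probability measure \<open>M\<close> on \<open>[0,1)\<close> the Kaczmarz algorithm along the characters
  \<open>e\<^sub>0, e\<^sub>1, \<dots>\<close> converges for every function (Kwapien--Mycielski). By stationarity, the functions for which
  it converges are closed under multiplication by \<open>e\<^sub>1\<close> and \<open>e\<^bsub>-1\<^esub>\<close> as soon as it converges for
  \<open>e\<^bsub>-1\<^esub>\<close>, and then they are everything by Stone--Weierstrass. The coefficients for \<open>e\<^bsub>-1\<^esub>\<close> are the Taylor
  coefficients of \<open>b / z\<close>, where the Cauchy transform of \<open>M\<close> is \<open>1 / (1 - b)\<close>. The Poisson integral
  of \<open>M\<close> equals \<open>(1 - \<bar>b\<bar>\<^sup>2) / \<bar>1 - b\<bar>\<^sup>2\<close> and tends to \<open>0\<close> in measure by singularity, so \<open>b\<close> is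
  inner and the squared moduli of its coefficients sum to \<open>1\<close>, as convergence requires.

  Running the algorithm in each \<open>L\<^sup>2(\<rho>\<^sub>x)\<close> gives coefficients \<open>c\<^sub>n(x)\<close> in \<open>L\<^sup>2(\<mu>\<^sub>1)\<close>, and dominated
  convergence gives \<open>f(x,y) = \<Sum>\<^sub>n c\<^sub>n(x) e\<^sub>n(y)\<close> in \<open>L\<^sup>2(\<mu>)\<close>; each \<open>c\<^sub>n\<close> is then expanded in \<open>L\<^sup>2(\<mu>\<^sub>1)\<close>
  by the same algorithm.
\<close>

section \<open>Square-integrable functions\<close>

text \<open>The squared norm is the working quantity because each projection step lowers it by an
  exact amount (\<open>L2_sq_kaczmarz_Suc\<close>).\<close>

definition L2_sq :: "'a measure \<Rightarrow> ('a \<Rightarrow> complex) \<Rightarrow> real" where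
  "L2_sq M f = (LINT z|M. (cmod (f z))\<^sup>2)"

lemma L2_norm_eq: "L2_norm M f = sqrt (L2_sq M f)"
  by (simp add: L2_norm_def L2_sq_def)

lemma L2_sq_nonneg [simp]: "0 \<le> L2_sq M f"
  by (simp add: L2_sq_def)

lemma L2_measurable [measurable_dest]: "f \<in> L2 M \<Longrightarrow> f \<in> borel_measurable M"
  by (simp add: L2_def)

lemma L2_integrable_sq: "f \<in> L2 M \<Longrightarrow> integrable M (\<lambda>z. (cmod (f z))\<^sup>2)"
  by (simp add: L2_def)

lemma cmod_add_sq_le: "(cmod (a + b))\<^sup>2 \<le> 2 * (cmod a)\<^sup>2 + 2 * (cmod b)\<^sup>2"
proof -
  have "(cmod (a + b))\<^sup>2 \<le> (cmod a + cmod b)\<^sup>2"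
    by (intro power_mono norm_triangle_ineq norm_ge_zero)
  also have "\<dots> \<le> 2 * (cmod a)\<^sup>2 + 2 * (cmod b)\<^sup>2"
    using sum_squares_bound[of "cmod a" "cmod b"] by (simp add: power2_sum)
  finally show ?thesis .
qed

lemma L2_bounded_mult:
  assumes f: "f \<in> L2 M" and h[measurable]: "h \<in> borel_measurable M"
    and B: "AE z in M. cmod (h z) \<le> B"
  shows "(\<lambda>z. h z * f z) \<in> L2 M"
proof -
  note [measurable] = L2_measurable[OF f]
  have "integrable M (\<lambda>z. (cmod (h z * f z))\<^sup>2)"
  proof (rule Bochner_Integration.integrable_bound)
    show "integrable M (\<lambda>z. B\<^sup>2 * (cmod (f z))\<^sup>2)"
      using L2_integrable_sq[OF f] by simp
    show "AE z in M. norm ((cmod (h z * f z))\<^sup>2) \<le> norm (B\<^sup>2 * (cmod (f z))\<^sup>2)"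
      using B by eventually_elim
        (auto simp: norm_mult power_mult_distrib intro!: mult_right_mono power_mono)
  qed measurable
  then show ?thesis by (simp add: L2_def)
qed

lemma L2_add:
  assumes f: "f \<in> L2 M" and g: "g \<in> L2 M"
  shows "(\<lambda>z. f z + g z) \<in> L2 M"
proof -
  note [measurable] = L2_measurable[OF f] L2_measurable[OF g]
  have "integrable M (\<lambda>z. (cmod (f z + g z))\<^sup>2)"
    by (rule Bochner_Integration.integrable_bound[where f="\<lambda>z. 2 * (cmod (f z))\<^sup>2 + 2 * (cmod (g z))\<^sup>2"])
      (use L2_integrable_sq[OF f] L2_integrable_sq[OF g] cmod_add_sq_le in auto)
  then show ?thesis by (simp add: L2_def)
qed

lemma L2_cmult: "f \<in> L2 M \<Longrightarrow> (\<lambda>z. c * f z) \<in> L2 M"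
  by (rule L2_bounded_mult[where B="cmod c"]) auto

lemma L2_diff: "f \<in> L2 M \<Longrightarrow> g \<in> L2 M \<Longrightarrow> (\<lambda>z. f z - g z) \<in> L2 M"
  using L2_add[of f M "\<lambda>z. (-1) * g z"] L2_cmult[of g M "-1"] by simp

lemma L2_sum: "(\<And>i. i \<in> I \<Longrightarrow> f i \<in> L2 M) \<Longrightarrow> (\<lambda>z. \<Sum>i\<in>I. f i z) \<in> L2 M"
proof (induction I rule: infinite_finite_induct)
  case (insert i I)
  then show ?case using L2_add[of "f i" M "\<lambda>z. \<Sum>i\<in>I. f i z"] by simp
qed (auto simp: L2_def)

lemma L2_sq_cmult: "L2_sq M (\<lambda>z. c * f z) = (cmod c)\<^sup>2 * L2_sq M f"
  by (simp add: L2_sq_def norm_mult power_mult_distrib)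

lemma L2_sq_add_le:
  assumes "f \<in> L2 M" "g \<in> L2 M"
  shows "L2_sq M (\<lambda>z. f z + g z) \<le> 2 * L2_sq M f + 2 * L2_sq M g"
proof -
  note [simp] = L2_integrable_sq[OF assms(1)] L2_integrable_sq[OF assms(2)]
  have "L2_sq M (\<lambda>z. f z + g z) \<le> (LINT z|M. 2 * (cmod (f z))\<^sup>2 + 2 * (cmod (g z))\<^sup>2)"
    unfolding L2_sq_def
    using L2_integrable_sq[OF L2_add[OF assms]] cmod_add_sq_le by (intro integral_mono) auto
  then show ?thesis by (simp add: L2_sq_def)
qed

lemma cmod_mult_le_squares: "cmod (a * cnj b) \<le> (cmod a)\<^sup>2 + (cmod b)\<^sup>2"
proof -
  have "2 * (cmod a * cmod b) \<le> (cmod a)\<^sup>2 + (cmod b)\<^sup>2"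
    using sum_squares_bound[of "cmod a" "cmod b"] by simp
  moreover have "0 \<le> cmod a * cmod b" by simp
  ultimately have "cmod a * cmod b \<le> (cmod a)\<^sup>2 + (cmod b)\<^sup>2" by linarith
  then show ?thesis by (simp add: norm_mult)
qed

lemma borel_measurable_cnj [measurable]: "cnj \<in> borel_measurable borel"
  by (intro borel_measurable_continuous_onI continuous_intros)

lemma integrable_mult_cnj:
  assumes f: "f \<in> L2 M" and g: "g \<in> L2 M"
  shows "integrable M (\<lambda>z. f z * cnj (g z))"
proof -
  note [measurable] = L2_measurable[OF f] L2_measurable[OF g]
  have "AE z in M. cmod (f z * cnj (g z)) \<le> norm ((cmod (f z))\<^sup>2 + (cmod (g z))\<^sup>2)"
    using cmod_mult_le_squares by auto
  then show ?thesis
    by (rule Bochner_Integration.integrable_bound[where f="\<lambda>z. (cmod (f z))\<^sup>2 + (cmod (g z))\<^sup>2", rotated 2])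
      (use L2_integrable_sq[OF f] L2_integrable_sq[OF g] in auto)
qed

lemma L2_sq_dominated_convergence:
  assumes s: "\<And>k. s k \<in> borel_measurable M" and w: "w \<in> L2 M"
    and bound: "\<And>k. AE z in M. cmod (s k z) \<le> cmod (w z)"
    and lim: "AE z in M. (\<lambda>k. s k z) \<longlonglongrightarrow> 0"
  shows "(\<lambda>k. L2_sq M (s k)) \<longlonglongrightarrow> 0"
proof -
  note [measurable] = s L2_measurable[OF w]
  have "(\<lambda>k. LINT z|M. (cmod (s k z))\<^sup>2) \<longlonglongrightarrow> (LINT z|M. (0::real))"
  proof (rule integral_dominated_convergence[where w="\<lambda>z. (cmod (w z))\<^sup>2"])
    show "AE z in M. (\<lambda>k. (cmod (s k z))\<^sup>2) \<longlonglongrightarrow> 0"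
      using lim
    proof eventually_elim
      case (elim z)
      then show ?case using tendsto_power[OF tendsto_norm_zero, of "\<lambda>k. s k z" _ 2] by simp
    qed
    show "AE z in M. norm ((cmod (s k z))\<^sup>2) \<le> (cmod (w z))\<^sup>2" for k
      using bound[of k] by eventually_elim (simp add: power_mono)
  qed (use L2_integrable_sq[OF w] in auto)
  then show ?thesis by (simp add: L2_sq_def)
qed

lemma L2_sums_I:
  assumes "\<And>k. u k \<in> L2 M" "f \<in> L2 M"
    and "(\<lambda>N. L2_sq M (\<lambda>z. f z - (\<Sum>k<N. u k z))) \<longlonglongrightarrow> 0"
  shows "L2_sums M u f"
proof -
  have "L2_sq M (\<lambda>z. (\<Sum>k<N. u k z) - f z) = L2_sq M (\<lambda>z. f z - (\<Sum>k<N. u k z))" for N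
    unfolding L2_sq_def by (simp add: norm_minus_commute)
  then have "(\<lambda>N. L2_norm M (\<lambda>z. (\<Sum>k<N. u k z) - f z)) \<longlonglongrightarrow> sqrt 0"
    unfolding L2_norm_eq using tendsto_real_sqrt[OF assms(3)] by simp
  then show ?thesis using assms(1,2) by (simp add: L2_sums_def)
qed

section \<open>Characters of the circle\<close>

definition chr :: "int \<Rightarrow> real \<Rightarrow> complex" where
  "chr n y = cis (2 * pi * of_int n * y)"

lemma chr_0 [simp]: "chr 0 = (\<lambda>y. 1)"
  by (auto simp: chr_def)

lemma chr_add: "chr (m + n) y = chr m y * chr n y"
  by (simp add: chr_def cis_mult ring_distribs)

lemma cnj_chr [simp]: "cnj (chr n y) = chr (- n) y"
  by (simp add: chr_def cis_cnj)

lemma norm_chr [simp]: "cmod (chr n y) = 1"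
  by (simp add: chr_def)

lemma chr_mult_chr_minus [simp]:
  "chr n y * chr (- n) y = 1" "chr (- n) y * chr n y = 1"
  by (simp_all flip: chr_add)

lemma chr_power: "chr n y ^ k = chr (int k * n) y"
proof -
  have "real k * (2 * pi * of_int n * y) = 2 * pi * of_int (int k * n) * y" by simp
  then show ?thesis unfolding chr_def Complex.DeMoivre by (rule arg_cong)
qed

lemma chr_eq_exp:
  "chr (int n) y = exp (2 * of_real pi * \<i> * of_real (real n * y))"
  by (simp add: chr_def cis_conv_exp mult_ac)

text \<open>This left inverse of \<open>chr 1\<close> on \<open>[0,1)\<close> is the bridge from
  Borel sets of the circle to Borel sets of the interval.\<close>

lemma Arg2pi_chr: "y \<in> {0..<1} \<Longrightarrow> Arg2pi (chr 1 y) = 2 * pi * y"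
  by (rule Arg2pi_unique[where r=1]) (auto simp: chr_def cis_conv_exp)

lemma continuous_on_chr [continuous_intros]:
  "continuous_on A f \<Longrightarrow> continuous_on A (\<lambda>x. chr n (f x))"
  unfolding chr_def by (intro continuous_intros)

lemma borel_measurable_chr [measurable]: "chr n \<in> borel_measurable borel"
  by (intro borel_measurable_continuous_onI continuous_intros)

section \<open>The Kaczmarz algorithm\<close>

text \<open>The recursion follows the residual rather than the approximant: the residual is linear
  in \<open>f\<close>, and for a probability measure each step is the orthogonal projection that
  removes the unit vector \<open>chr n\<close>.\<close>

primrec kaczmarz_residual :: "real measure \<Rightarrow> (real \<Rightarrow> complex) \<Rightarrow> nat \<Rightarrow> real \<Rightarrow> complex" where
  "kaczmarz_residual M f 0 = f"
| "kaczmarz_residual M f (Suc n) =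
     (\<lambda>y. kaczmarz_residual M f n y
        - (LINT t|M. kaczmarz_residual M f n t * cnj (chr (int n) t)) * chr (int n) y)"

definition kaczmarz_coeff :: "real measure \<Rightarrow> (real \<Rightarrow> complex) \<Rightarrow> nat \<Rightarrow> complex" where
  "kaczmarz_coeff M f n = (LINT t|M. kaczmarz_residual M f n t * cnj (chr (int n) t))"

lemma kaczmarz_residual_Suc:
  "kaczmarz_residual M f (Suc n) =
    (\<lambda>y. kaczmarz_residual M f n y - kaczmarz_coeff M f n * chr (int n) y)"
  by (simp add: kaczmarz_coeff_def)

declare kaczmarz_residual.simps(2) [simp del]

lemma kaczmarz_residual_eq:
  "kaczmarz_residual M f n y = f y - (\<Sum>k<n. kaczmarz_coeff M f k * chr (int k) y)"
  by (induction n) (simp_all add: kaczmarz_residual_Suc)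

locale circle_measure = prob_space M for M :: "real measure" +
  assumes sets_eq_borel: "sets M = sets borel"
    and AE_unit_interval: "AE y in M. y \<in> {0..<1}"
begin

lemma borel_measurable_M_iff: "borel_measurable M = borel_measurable borel"
  by (rule measurable_cong_sets) (simp_all add: sets_eq_borel)

lemma space_eq_UNIV [simp]: "space M = UNIV"
  using sets_eq_imp_space_eq[OF sets_eq_borel] by simp

lemma prob_UNIV [simp]: "prob UNIV = 1"
  using prob_space by simp

lemma chr_measurable [measurable]: "chr n \<in> borel_measurable M"
  by (simp add: borel_measurable_M_iff)

lemma bounded_L2:
  assumes [measurable]: "f \<in> borel_measurable M" and B: "\<And>y. cmod (f y) \<le> B"
  shows "f \<in> L2 M"
proof -
  have "integrable M (\<lambda>z. (cmod (f z))\<^sup>2)"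
    by (rule integrable_const_bound[where B="B\<^sup>2"]) (auto intro!: power_mono B)
  then show ?thesis by (simp add: L2_def)
qed

lemma chr_L2 [simp]: "chr n \<in> L2 M"
  by (rule bounded_L2[where B=1]) auto

lemma chr_mult_L2: "f \<in> L2 M \<Longrightarrow> (\<lambda>y. chr n y * f y) \<in> L2 M"
  by (rule L2_bounded_mult[where B=1]) auto

lemma L2_sq_chr_mult: "L2_sq M (\<lambda>y. chr n y * f y) = L2_sq M f"
  by (simp add: L2_sq_def norm_mult)

lemma integrable_chr [simp]: "integrable M (chr n)"
  by (rule integrable_const_bound[where B=1]) auto

text \<open>Pythagoras: \<open>chr n\<close> is a unit vector because \<open>M\<close> is a
  probability measure, and \<open>c\<close> is the inner product of \<open>f\<close> with
  it.\<close>

lemma L2_sq_diff_projection: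
  fixes n :: int
  assumes f: "f \<in> L2 M"
  defines "c \<equiv> (LINT t|M. f t * cnj (chr n t))"
  shows "L2_sq M (\<lambda>y. f y - c * chr n y) = L2_sq M f - (cmod c)\<^sup>2"
proof -
  have eq: "(cmod (f y - c * chr n y))\<^sup>2 =
      (cmod (f y))\<^sup>2 + (cmod c)\<^sup>2 - 2 * Re (cnj c * (f y * cnj (chr n y)))" for y
  proof -
    have "(cmod (f y - c * chr n y))\<^sup>2 =
        (cmod (f y))\<^sup>2 + (cmod (c * chr n y))\<^sup>2 - 2 * Re (f y * cnj (c * chr n y))"
      by (simp only: cmod_power2) (simp add: power2_eq_square algebra_simps del: cnj_chr)
    then show ?thesis by (simp add: norm_mult mult_ac)
  qed
  have i: "integrable M (\<lambda>y. f y * cnj (chr n y))"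
    by (rule integrable_mult_cnj[OF f]) simp
  define q where "q y = Re (cnj c * (f y * cnj (chr n y)))" for y
  have "integrable M q"
    unfolding q_def using i by (intro integrable_Re integrable_mult_right)
  moreover have "integral\<^sup>L M q = (cmod c)\<^sup>2"
  proof -
    have "integral\<^sup>L M q = Re (LINT y|M. cnj c * (f y * cnj (chr n y)))"
      unfolding q_def using i by (intro integral_Re integrable_mult_right)
    also have "(LINT y|M. cnj c * (f y * cnj (chr n y))) = cnj c * c"
      by (simp add: c_def)
    finally show ?thesis by (simp add: cmod_power2) (simp add: power2_eq_square)
  qed
  ultimately show ?thesis
    unfolding L2_sq_def eq q_def[symmetric] using L2_integrable_sq[OF f] by simp
qed

lemma kaczmarz_residual_L2:
  assumes "f \<in> L2 M" shows "kaczmarz_residual M f n \<in> L2 M"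
proof (induction n)
  case (Suc n)
  then show ?case
    unfolding kaczmarz_residual_Suc by (intro L2_diff L2_cmult) simp_all
qed (simp add: assms)

lemma integrable_kaczmarz:
  "f \<in> L2 M \<Longrightarrow> integrable M (\<lambda>t. kaczmarz_residual M f n t * cnj (chr m t))"
  by (intro integrable_mult_cnj kaczmarz_residual_L2) simp_all

lemma L2_sq_kaczmarz_Suc:
  "f \<in> L2 M \<Longrightarrow> L2_sq M (kaczmarz_residual M f (Suc n)) =
     L2_sq M (kaczmarz_residual M f n) - (cmod (kaczmarz_coeff M f n))\<^sup>2"
  using L2_sq_diff_projection[OF kaczmarz_residual_L2]
  by (simp add: kaczmarz_residual_Suc kaczmarz_coeff_def)

text \<open>The one-step identity telescopes. Hence the residuals tend to 0 exactly when the squared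
  coefficients sum to \<open>L2_sq M f\<close>; this is the criterion checked later for
  \<open>chr (-1)\<close>.\<close>

lemma L2_sq_kaczmarz:
  "f \<in> L2 M \<Longrightarrow> L2_sq M (kaczmarz_residual M f n) =
     L2_sq M f - (\<Sum>k<n. (cmod (kaczmarz_coeff M f k))\<^sup>2)"
  by (induction n) (simp_all add: L2_sq_kaczmarz_Suc)

lemma L2_sq_kaczmarz_le: "f \<in> L2 M \<Longrightarrow> L2_sq M (kaczmarz_residual M f n) \<le> L2_sq M f"
  by (simp add: L2_sq_kaczmarz sum_nonneg)

lemma cmod_kaczmarz_coeff_sq_le:
  "f \<in> L2 M \<Longrightarrow> (cmod (kaczmarz_coeff M f n))\<^sup>2 \<le> L2_sq M (kaczmarz_residual M f n)"
  using L2_sq_kaczmarz_Suc[of f n] L2_sq_nonneg[of M "kaczmarz_residual M f (Suc n)"] by linarith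

lemma kaczmarz_residual_add:
  assumes "f \<in> L2 M" "g \<in> L2 M"
  shows "kaczmarz_residual M (\<lambda>y. f y + g y) n y =
    kaczmarz_residual M f n y + kaczmarz_residual M g n y"
proof (induction n arbitrary: y)
  case (Suc n)
  have "kaczmarz_coeff M (\<lambda>y. f y + g y) n = kaczmarz_coeff M f n + kaczmarz_coeff M g n"
    unfolding kaczmarz_coeff_def Suc
    using integrable_kaczmarz[OF assms(1)] integrable_kaczmarz[OF assms(2)]
    by (simp add: ring_distribs del: cnj_chr)
  with Suc show ?case by (simp add: kaczmarz_residual_Suc algebra_simps)
qed simp

lemma kaczmarz_residual_cmult:
  "kaczmarz_residual M (\<lambda>y. c * f y) n y = c * kaczmarz_residual M f n y"
proof (induction n arbitrary: y)
  case (Suc n)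
  have "kaczmarz_coeff M (\<lambda>y. c * f y) n = c * kaczmarz_coeff M f n"
    unfolding kaczmarz_coeff_def Suc by (simp add: mult.assoc)
  with Suc show ?case by (simp add: kaczmarz_residual_Suc algebra_simps)
qed simp

text \<open>The first direction \<open>chr 0\<close> is the constant 1, so step 0 already removes
  everything.\<close>

lemma kaczmarz_residual_1: "kaczmarz_residual M (\<lambda>y. 1) (Suc n) = (\<lambda>y. 0)"
  by (induction n) (simp_all add: kaczmarz_residual_Suc kaczmarz_coeff_def prob_space)

text \<open>Stationarity: inner products of characters depend only on the difference of the indices,
  so multiplication by \<open>chr 1\<close> turns step \<open>n\<close> into step
  \<open>n + 1\<close>. The extra step 0 subtracts the mean \<open>a\<close> of the product; as
  \<open>a = chr 1 y * (a * chr (-1) y)\<close>, it leaves \<open>chr 1\<close> times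
  \<open>f - a * chr (-1)\<close>, and linearity gives the two terms.\<close>

lemma kaczmarz_residual_shift:
  assumes f: "f \<in> L2 M"
  shows "kaczmarz_residual M (\<lambda>y. chr 1 y * f y) (Suc n) y =
    chr 1 y * kaczmarz_residual M f n y
    - (LINT t|M. chr 1 t * f t) * (chr 1 y * kaczmarz_residual M (chr (-1)) n y)"
proof (induction n arbitrary: y)
  case 0
  show ?case
    by (simp add: kaczmarz_residual_Suc kaczmarz_coeff_def)
next
  case (Suc n)
  let ?g = "\<lambda>y. chr 1 y * f y" and ?a = "LINT t|M. chr 1 t * f t"
  have shift: "chr 1 t * u * cnj (chr (int (Suc n)) t) = u * cnj (chr (int n) t)" for t u
  proof -
    have "chr 1 t * chr (- int (Suc n)) t = chr (- int n) t"
      by (simp flip: chr_add)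
    then show ?thesis by (simp add: mult_ac)
  qed
  have "kaczmarz_coeff M ?g (Suc n) =
    (LINT t|M. kaczmarz_residual M f n t * cnj (chr (int n) t)
       - ?a * (kaczmarz_residual M (chr (-1)) n t * cnj (chr (int n) t)))"
    unfolding kaczmarz_coeff_def Suc shift[symmetric]
    by (intro Bochner_Integration.integral_cong refl) (simp add: algebra_simps del: cnj_chr)
  also have "\<dots> = kaczmarz_coeff M f n - ?a * kaczmarz_coeff M (chr (-1)) n"
    unfolding kaczmarz_coeff_def
    using integrable_kaczmarz[OF f] integrable_kaczmarz[of "chr (-1)"]
    by (simp del: cnj_chr)
  finally have c: "kaczmarz_coeff M ?g (Suc n) = \<dots>" .
  have "chr (int (Suc n)) y = chr 1 y * chr (int n) y"
    by (simp flip: chr_add)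
  then show ?case
    unfolding kaczmarz_residual_Suc[of M ?g "Suc n"] Suc c
    by (simp add: kaczmarz_residual_Suc algebra_simps)
qed

end

section \<open>Functions with convergent algorithm and their multipliers\<close>

context circle_measure
begin

definition kaczmarz_convergent :: "(real \<Rightarrow> complex) set" where
  "kaczmarz_convergent =
     {f \<in> L2 M. (\<lambda>n. L2_sq M (kaczmarz_residual M f n)) \<longlonglongrightarrow> 0}"

lemma kaczmarz_convergent_L2: "f \<in> kaczmarz_convergent \<Longrightarrow> f \<in> L2 M"
  by (simp add: kaczmarz_convergent_def)

lemma kaczmarz_convergent_add:
  assumes "f \<in> kaczmarz_convergent" "g \<in> kaczmarz_convergent"
  shows "(\<lambda>y. f y + g y) \<in> kaczmarz_convergent"
proof -
  note L2 = assms[THEN kaczmarz_convergent_L2]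
  have lim: "(\<lambda>n. 2 * L2_sq M (kaczmarz_residual M f n) + 2 * L2_sq M (kaczmarz_residual M g n))
      \<longlonglongrightarrow> 2 * 0 + 2 * 0"
    using assms by (intro tendsto_intros) (simp_all add: kaczmarz_convergent_def)
  have "(\<lambda>n. L2_sq M (kaczmarz_residual M (\<lambda>y. f y + g y) n)) \<longlonglongrightarrow> 0"
  proof (rule tendsto_sandwich[OF _ _ tendsto_const])
    show "\<forall>\<^sub>F n in sequentially. L2_sq M (kaczmarz_residual M (\<lambda>y. f y + g y) n) \<le>
        2 * L2_sq M (kaczmarz_residual M f n) + 2 * L2_sq M (kaczmarz_residual M g n)"
      using L2_sq_add_le[OF L2[THEN kaczmarz_residual_L2]]
      by (simp add: kaczmarz_residual_add[OF L2, abs_def])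
  qed (use lim in simp_all)
  then show ?thesis by (simp add: kaczmarz_convergent_def L2_add L2)
qed

lemma kaczmarz_convergent_cmult:
  assumes "f \<in> kaczmarz_convergent"
  shows "(\<lambda>y. c * f y) \<in> kaczmarz_convergent"
proof -
  have "(\<lambda>n. (cmod c)\<^sup>2 * L2_sq M (kaczmarz_residual M f n)) \<longlonglongrightarrow> (cmod c)\<^sup>2 * 0"
    using assms by (intro tendsto_intros) (simp_all add: kaczmarz_convergent_def)
  then show ?thesis
    using assms
    by (simp add: kaczmarz_convergent_def L2_cmult kaczmarz_residual_cmult[abs_def] L2_sq_cmult)
qed

text \<open>No residual map increases the norm (\<open>L2_sq_kaczmarz_le\<close>), so one good
  approximant \<open>g k\<close> controls the residuals of \<open>f\<close> uniformly in
  \<open>n\<close>.\<close>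

lemma kaczmarz_convergent_closed:
  assumes f: "f \<in> L2 M" and g: "\<And>k. g k \<in> kaczmarz_convergent"
    and lim: "(\<lambda>k. L2_sq M (\<lambda>y. f y - g k y)) \<longlonglongrightarrow> 0"
  shows "f \<in> kaczmarz_convergent"
proof -
  have "(\<lambda>n. L2_sq M (kaczmarz_residual M f n)) \<longlonglongrightarrow> 0"
  proof (rule LIMSEQ_I)
    fix e :: real assume "e > 0"
    \<comment> \<open>Each of the two terms gets a quarter of \<open>e\<close> because
      \<open>L2_sq_add_le\<close> costs a factor 2.\<close>
    from LIMSEQ_D[OF lim, of "e/4"] \<open>e > 0\<close>
    obtain k where k: "L2_sq M (\<lambda>y. f y - g k y) < e/4" by auto
    have gk: "g k \<in> L2 M" by (rule kaczmarz_convergent_L2[OF g])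
    note d = L2_diff[OF f gk]
    have "(\<lambda>n. L2_sq M (kaczmarz_residual M (g k) n)) \<longlonglongrightarrow> 0"
      using g[of k] by (simp add: kaczmarz_convergent_def)
    from LIMSEQ_D[OF this, of "e/4"] \<open>e > 0\<close>
    obtain N where N: "\<And>n. n \<ge> N \<Longrightarrow> L2_sq M (kaczmarz_residual M (g k) n) < e/4" by auto
    have "L2_sq M (kaczmarz_residual M f n) < e" if "n \<ge> N" for n
    proof -
      have "kaczmarz_residual M f n =
          (\<lambda>y. kaczmarz_residual M (g k) n y + kaczmarz_residual M (\<lambda>y. f y - g k y) n y)"
        using kaczmarz_residual_add[OF gk d] by (auto simp: fun_eq_iff)
      then have "L2_sq M (kaczmarz_residual M f n) \<le>
          2 * L2_sq M (kaczmarz_residual M (g k) n)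
          + 2 * L2_sq M (kaczmarz_residual M (\<lambda>y. f y - g k y) n)"
        using L2_sq_add_le[OF kaczmarz_residual_L2[OF gk] kaczmarz_residual_L2[OF d]] by metis
      also have "\<dots> < e"
        using N[OF that] L2_sq_kaczmarz_le[OF d, of n] k by linarith
      finally show ?thesis .
    qed
    then show "\<exists>N. \<forall>n\<ge>N. norm (L2_sq M (kaczmarz_residual M f n) - 0) < e" by auto
  qed
  with f show ?thesis by (simp add: kaczmarz_convergent_def)
qed

lemma one_kaczmarz_convergent: "(\<lambda>y. 1) \<in> kaczmarz_convergent"
proof -
  have "(\<lambda>n. L2_sq M (kaczmarz_residual M (\<lambda>y. 1) (Suc n))) \<longlonglongrightarrow> 0"
    by (simp add: kaczmarz_residual_1 L2_sq_def)
  then have "(\<lambda>n. L2_sq M (kaczmarz_residual M (\<lambda>y. 1) n)) \<longlonglongrightarrow> 0"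
    by (rule LIMSEQ_imp_Suc)
  then show ?thesis using chr_L2[of 0] by (simp add: kaczmarz_convergent_def)
qed

text \<open>Unlike the convergent functions, these are closed under products as well as sums.
  Applied to the constant 1, they yield convergent functions.\<close>

definition kaczmarz_multiplier :: "(real \<Rightarrow> complex) set" where
  "kaczmarz_multiplier = {h \<in> borel_measurable borel.
     \<forall>f\<in>kaczmarz_convergent. (\<lambda>y. h y * f y) \<in> kaczmarz_convergent}"

lemma kaczmarz_multiplier_measurable [measurable_dest]:
  "h \<in> kaczmarz_multiplier \<Longrightarrow> h \<in> borel_measurable borel"
  by (simp add: kaczmarz_multiplier_def)

lemma kaczmarz_multiplierD:
  "h \<in> kaczmarz_multiplier \<Longrightarrow> f \<in> kaczmarz_convergent \<Longrightarrow>
    (\<lambda>y. h y * f y) \<in> kaczmarz_convergent"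
  by (simp add: kaczmarz_multiplier_def)

lemma const_kaczmarz_multiplier: "(\<lambda>y. c) \<in> kaczmarz_multiplier"
  by (simp add: kaczmarz_multiplier_def kaczmarz_convergent_cmult)

lemma kaczmarz_multiplier_add:
  "g \<in> kaczmarz_multiplier \<Longrightarrow> h \<in> kaczmarz_multiplier \<Longrightarrow>
    (\<lambda>y. g y + h y) \<in> kaczmarz_multiplier"
  by (auto simp: kaczmarz_multiplier_def ring_distribs intro!: kaczmarz_convergent_add)

lemma kaczmarz_multiplier_mult:
  "g \<in> kaczmarz_multiplier \<Longrightarrow> h \<in> kaczmarz_multiplier \<Longrightarrow>
    (\<lambda>y. g y * h y) \<in> kaczmarz_multiplier"
  by (auto simp: kaczmarz_multiplier_def mult.assoc)

lemma kaczmarz_multiplier_sum: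
  "(\<And>i. i \<in> I \<Longrightarrow> h i \<in> kaczmarz_multiplier) \<Longrightarrow>
    (\<lambda>y. \<Sum>i\<in>I. h i y) \<in> kaczmarz_multiplier"
  by (induction I rule: infinite_finite_induct)
    (auto intro: const_kaczmarz_multiplier kaczmarz_multiplier_add)

text \<open>The limit inherits the bound \<open>B\<close> almost everywhere, so the error is at most
  \<open>2 * B * cmod (f y)\<close>; dominated convergence and closedness of the convergent
  functions finish.\<close>

lemma kaczmarz_multiplier_limit:
  assumes h [measurable]: "h \<in> borel_measurable borel"
    and s: "\<And>k. s k \<in> kaczmarz_multiplier"
    and bound: "\<And>k y. cmod (s k y) \<le> B"
    and lim: "AE y in M. (\<lambda>k. s k y) \<longlonglongrightarrow> h y"
  shows "h \<in> kaczmarz_multiplier"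
proof -
  note [measurable] = s[THEN kaczmarz_multiplier_measurable]
  have meas: "h \<in> borel_measurable M" "\<And>k. s k \<in> borel_measurable M"
    by (simp_all add: borel_measurable_M_iff)
  have hB: "AE y in M. cmod (h y) \<le> B"
    using lim
  proof eventually_elim
    case (elim y)
    show ?case
      by (rule LIMSEQ_le_const2[OF tendsto_norm[OF elim]]) (use bound in auto)
  qed
  have "(\<lambda>y. h y * f y) \<in> kaczmarz_convergent" if f: "f \<in> kaczmarz_convergent" for f
  proof (rule kaczmarz_convergent_closed)
    have fL: "f \<in> L2 M" by (rule kaczmarz_convergent_L2[OF f])
    show "(\<lambda>y. h y * f y) \<in> L2 M" by (rule L2_bounded_mult[OF fL meas(1) hB])
    show "(\<lambda>y. s k y * f y) \<in> kaczmarz_convergent" for k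
      using s f by (rule kaczmarz_multiplierD)
    show "(\<lambda>k. L2_sq M (\<lambda>y. h y * f y - s k y * f y)) \<longlonglongrightarrow> 0"
    proof (rule L2_sq_dominated_convergence)
      show "(\<lambda>y. of_real (2 * B) * f y) \<in> L2 M" by (rule L2_cmult[OF fL])
      show "(\<lambda>y. h y * f y - s k y * f y) \<in> borel_measurable M" for k
        using meas L2_measurable[OF fL] by measurable
      show "AE y in M. cmod (h y * f y - s k y * f y) \<le> cmod (of_real (2 * B) * f y)" for k
        using hB
      proof eventually_elim
        case (elim y)
        have "cmod (h y * f y - s k y * f y) = cmod (h y - s k y) * cmod (f y)"
          by (simp flip: norm_mult add: left_diff_distrib)
        also have "\<dots> \<le> \<bar>2 * B\<bar> * cmod (f y)"
          using norm_triangle_ineq4[of "h y" "s k y"] elim bound[of k y]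
          by (intro mult_right_mono) auto
        finally show ?case by (simp add: norm_mult)
      qed
      show "AE y in M. (\<lambda>k. h y * f y - s k y * f y) \<longlonglongrightarrow> 0"
        using lim
      proof eventually_elim
        case (elim y)
        have "(\<lambda>k. h y * f y - s k y * f y) \<longlonglongrightarrow> h y * f y - h y * f y"
          by (intro tendsto_intros elim)
        then show ?case by simp
      qed
    qed
  qed
  then show ?thesis by (simp add: kaczmarz_multiplier_def)
qed

text \<open>Functions built on the circle match a given function on the line only over
  \<open>[0,1)\<close>, that is, almost everywhere.\<close>

lemma kaczmarz_multiplier_cong:
  assumes "g \<in> kaczmarz_multiplier" "h \<in> borel_measurable borel" "\<And>y. cmod (h y) \<le> B"
    and "AE y in M. g y = h y"
  shows "h \<in> kaczmarz_multiplier"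
proof -
  have "(\<lambda>y. h y * f y) \<in> kaczmarz_convergent" if f: "f \<in> kaczmarz_convergent" for f
  proof (rule kaczmarz_convergent_closed)
    show "(\<lambda>y. h y * f y) \<in> L2 M"
      by (rule L2_bounded_mult[OF kaczmarz_convergent_L2[OF f], where B=B])
        (use assms in \<open>auto simp: borel_measurable_M_iff\<close>)
    show "(\<lambda>y. g y * f y) \<in> kaczmarz_convergent"
      by (rule kaczmarz_multiplierD[OF assms(1) f])
    have "AE y in M. (cmod (h y * f y - g y * f y))\<^sup>2 = 0"
      using assms(4) by eventually_elim simp
    then have "L2_sq M (\<lambda>y. h y * f y - g y * f y) = 0"
      unfolding L2_sq_def by (rule integral_eq_zero_AE)
    then show "(\<lambda>k. L2_sq M (\<lambda>y. h y * f y - g y * f y)) \<longlonglongrightarrow> 0" by simp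
  qed
  with assms(2) show ?thesis by (simp add: kaczmarz_multiplier_def)
qed

section \<open>From convergence for \<open>chr (-1)\<close> to convergence for every
  function\<close>

context
  assumes minus_one: "chr (-1) \<in> kaczmarz_convergent"
begin

lemma shift_residual_tendsto:
  "(\<lambda>n. 2 * L2_sq M (\<lambda>y. c * (chr 1 y * kaczmarz_residual M (chr (-1)) n y))) \<longlonglongrightarrow> 0"
proof -
  have "(\<lambda>n. 2 * ((cmod c)\<^sup>2 * L2_sq M (kaczmarz_residual M (chr (-1)) n))) \<longlonglongrightarrow> 2 * ((cmod c)\<^sup>2 * 0)"
    using minus_one by (intro tendsto_intros) (simp add: kaczmarz_convergent_def)
  then show ?thesis by (simp add: L2_sq_cmult L2_sq_chr_mult)
qed

text \<open>In the shift identity both terms on the right tend to 0: one is a unimodular multiple of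
  a residual of \<open>f\<close>, the other a bounded multiple of a residual of
  \<open>chr (-1)\<close>.\<close>

lemma chr_1_multiplier: "chr 1 \<in> kaczmarz_multiplier"
proof -
  have "(\<lambda>y. chr 1 y * f y) \<in> kaczmarz_convergent" if f: "f \<in> kaczmarz_convergent" for f
  proof -
    have fL: "f \<in> L2 M" by (rule kaczmarz_convergent_L2[OF f])
    let ?g = "\<lambda>y. chr 1 y * f y" and ?a = "LINT t|M. chr 1 t * f t"
    let ?u = "\<lambda>n y. chr 1 y * kaczmarz_residual M f n y"
    let ?v = "\<lambda>n y. (- ?a) * (chr 1 y * kaczmarz_residual M (chr (-1)) n y)"
    have eq: "kaczmarz_residual M ?g (Suc n) = (\<lambda>y. ?u n y + ?v n y)" for n
      using kaczmarz_residual_shift[OF fL] by (auto simp: fun_eq_iff)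
    have u: "?u n \<in> L2 M" and v: "?v n \<in> L2 M" for n
      by (intro L2_cmult chr_mult_L2 kaczmarz_residual_L2 fL chr_L2)+
    have lim: "(\<lambda>n. 2 * L2_sq M (?u n) + 2 * L2_sq M (?v n)) \<longlonglongrightarrow> 2 * 0 + 0"
      by (intro tendsto_add shift_residual_tendsto tendsto_mult tendsto_const)
        (use f in \<open>simp add: kaczmarz_convergent_def L2_sq_chr_mult\<close>)
    have "(\<lambda>n. L2_sq M (kaczmarz_residual M ?g (Suc n))) \<longlonglongrightarrow> 0"
    proof (rule tendsto_sandwich[OF _ _ tendsto_const])
      show "\<forall>\<^sub>F n in sequentially. L2_sq M (kaczmarz_residual M ?g (Suc n)) \<le>
          2 * L2_sq M (?u n) + 2 * L2_sq M (?v n)"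
        unfolding eq using L2_sq_add_le[OF u v] by (intro always_eventually allI)
    qed (use lim in simp_all)
    then have "(\<lambda>n. L2_sq M (kaczmarz_residual M ?g n)) \<longlonglongrightarrow> 0"
      by (rule LIMSEQ_imp_Suc)
    then show ?thesis by (simp add: kaczmarz_convergent_def chr_mult_L2 fL)
  qed
  then show ?thesis by (simp add: kaczmarz_multiplier_def)
qed

text \<open>The shift identity is applied to \<open>chr (-1) y * f y\<close>, whose product with
  \<open>chr 1\<close> is \<open>f\<close>, and solved for the residual of that function.\<close>

lemma chr_minus_1_multiplier: "chr (-1) \<in> kaczmarz_multiplier"
proof -
  have "(\<lambda>y. chr (-1) y * f y) \<in> kaczmarz_convergent" if f: "f \<in> kaczmarz_convergent" for f
  proof -
    have fL: "f \<in> L2 M" by (rule kaczmarz_convergent_L2[OF f])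
    let ?g = "\<lambda>y. chr (-1) y * f y" and ?a = "integral\<^sup>L M f"
    have gL: "?g \<in> L2 M" by (rule chr_mult_L2[OF fL])
    have fg: "(\<lambda>y. chr 1 y * ?g y) = f" by (simp flip: mult.assoc)
    let ?u = "\<lambda>n y. kaczmarz_residual M f (Suc n) y"
    let ?v = "\<lambda>n y. ?a * (chr 1 y * kaczmarz_residual M (chr (-1)) n y)"
    have eq: "(\<lambda>y. chr 1 y * kaczmarz_residual M ?g n y) = (\<lambda>y. ?u n y + ?v n y)" for n
      using kaczmarz_residual_shift[OF gL, unfolded fg] by (auto simp: fun_eq_iff)
    have u: "?u n \<in> L2 M" and v: "?v n \<in> L2 M" for n
      by (intro L2_cmult chr_mult_L2 kaczmarz_residual_L2 fL chr_L2)+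
    have "(\<lambda>n. L2_sq M (?u n)) \<longlonglongrightarrow> 0"
      by (rule LIMSEQ_Suc) (use f in \<open>simp add: kaczmarz_convergent_def\<close>)
    then have lim: "(\<lambda>n. 2 * L2_sq M (?u n) + 2 * L2_sq M (?v n)) \<longlonglongrightarrow> 2 * 0 + 0"
      by (intro tendsto_add shift_residual_tendsto tendsto_mult tendsto_const)
    have "(\<lambda>n. L2_sq M (\<lambda>y. chr 1 y * kaczmarz_residual M ?g n y)) \<longlonglongrightarrow> 0"
    proof (rule tendsto_sandwich[OF _ _ tendsto_const])
      show "\<forall>\<^sub>F n in sequentially. L2_sq M (\<lambda>y. chr 1 y * kaczmarz_residual M ?g n y) \<le>
          2 * L2_sq M (?u n) + 2 * L2_sq M (?v n)"
        unfolding eq using L2_sq_add_le[OF u v] by (intro always_eventually allI)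
    qed (use lim in simp_all)
    then show ?thesis by (simp add: kaczmarz_convergent_def gL L2_sq_chr_mult)
  qed
  then show ?thesis by (simp add: kaczmarz_multiplier_def)
qed

lemma real_polynomial_multiplier:
  assumes "real_polynomial_function p"
  shows "(\<lambda>y. complex_of_real (p (chr 1 y))) \<in> kaczmarz_multiplier"
  using assms
proof (induction p rule: real_polynomial_function.induct)
  case (linear h)
  interpret bounded_linear h by fact
  \<comment> \<open>On the unit circle the real part is half the sum of \<open>chr 1\<close> and
    \<open>chr (-1)\<close>, and the imaginary part is their difference over
    \<open>2 * \<i>\<close>; a real-linear \<open>h\<close> is determined by \<open>h 1\<close> and
    \<open>h \<i>\<close>.\<close>
  have "of_real (h (chr 1 y)) =
      (of_real (h 1) / 2 + of_real (h \<i>) / (2 * \<i>)) * chr 1 y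
      + (of_real (h 1) / 2 - of_real (h \<i>) / (2 * \<i>)) * chr (-1) y" for y
  proof -
    have "chr 1 y = Re (chr 1 y) *\<^sub>R 1 + Im (chr 1 y) *\<^sub>R \<i>" by (simp add: complex_eq_iff)
    then have "h (chr 1 y) = h (Re (chr 1 y) *\<^sub>R 1 + Im (chr 1 y) *\<^sub>R \<i>)" by (rule arg_cong)
    also have "\<dots> = Re (chr 1 y) * h 1 + Im (chr 1 y) * h \<i>" by (simp only: add scaleR) simp
    finally show ?thesis
      by (simp add: complex_eq_iff chr_def field_simps)
  qed
  then show ?case
    by (simp only:) (intro kaczmarz_multiplier_add kaczmarz_multiplier_mult
        const_kaczmarz_multiplier chr_1_multiplier chr_minus_1_multiplier)
qed (auto intro: const_kaczmarz_multiplier kaczmarz_multiplier_add kaczmarz_multiplier_mult)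

text \<open>Stone-Weierstrass on the compact circle gives real polynomials within
  \<open>1 / real (Suc k)\<close> of \<open>g\<close>. They are bounded by \<open>B + 1\<close>
  there, so the bounded limit lemma applies.\<close>

lemma continuous_multiplier:
  fixes g :: "complex \<Rightarrow> real"
  assumes g: "continuous_on UNIV g"
  shows "(\<lambda>y. complex_of_real (g (chr 1 y))) \<in> kaczmarz_multiplier"
proof -
  have cg: "continuous_on (sphere 0 1) g" using g continuous_on_subset by blast
  have "\<exists>p. real_polynomial_function p \<and> (\<forall>z\<in>sphere 0 1. \<bar>g z - p z\<bar> < 1 / real (Suc k))" for k
    by (rule Stone_Weierstrass_real_polynomial_function[OF compact_sphere cg,
          of "1 / real (Suc k)"]) auto
  then obtain p where p: "\<And>k. real_polynomial_function (p k)"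
    and pg: "\<And>k z. z \<in> sphere 0 1 \<Longrightarrow> \<bar>g z - p k z\<bar> < 1 / real (Suc k)"
    by metis
  have "bounded (g ` sphere 0 1)"
    by (intro compact_imp_bounded compact_continuous_image cg compact_sphere)
  then obtain B where B: "\<And>z. z \<in> sphere 0 1 \<Longrightarrow> \<bar>g z\<bar> \<le> B"
    unfolding bounded_iff by (metis (no_types, lifting) image_eqI real_norm_def)
  have chr: "chr 1 y \<in> sphere 0 1" for y by simp
  show ?thesis
  proof (rule kaczmarz_multiplier_limit)
    show "(\<lambda>y. complex_of_real (g (chr 1 y))) \<in> borel_measurable borel"
      by (intro borel_measurable_continuous_onI continuous_intros
          continuous_on_compose2[OF g]) auto
    show "(\<lambda>y. complex_of_real (p k (chr 1 y))) \<in> kaczmarz_multiplier" for k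
      by (rule real_polynomial_multiplier[OF p])
    show "cmod (complex_of_real (p k (chr 1 y))) \<le> B + 1" for k y
    proof -
      have "1 / real (Suc k) \<le> 1" by simp
      then show ?thesis
        using pg[OF chr, of y k] B[OF chr, of y] by (simp only: norm_of_real)
    qed
    have "(\<lambda>k. p k (chr 1 y)) \<longlonglongrightarrow> g (chr 1 y)" for y
    proof (rule LIMSEQ_I)
      fix e :: real assume "e > 0"
      then obtain N where N: "1 / real (Suc N) < e"
        using nat_approx_posE by blast
      have "norm (p k (chr 1 y) - g (chr 1 y)) < e" if "k \<ge> N" for k
      proof -
        have "1 / real (Suc k) \<le> 1 / real (Suc N)" using that by (simp add: frac_le)
        with N pg[OF chr, of y k] show ?thesis by (simp only: real_norm_def)
      qed
      then show "\<exists>N. \<forall>k\<ge>N. norm (p k (chr 1 y) - g (chr 1 y)) < e" by blast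
    qed
    then show "AE y in M. (\<lambda>k. complex_of_real (p k (chr 1 y))) \<longlonglongrightarrow> complex_of_real (g (chr 1 y))"
      by (intro AE_I2 tendsto_of_real)
  qed
qed

text \<open>Open sets are stable under intersection and generate the Borel sets, so the induction
  needs only open sets, complements and disjoint countable unions.\<close>

lemma indicator_circle_multiplier:
  fixes B :: "complex set"
  assumes "B \<in> sets borel"
  shows "(\<lambda>y. indicator B (chr 1 y)) \<in> kaczmarz_multiplier"
proof -
  have "Int_stable {U :: complex set. open U}" "{U :: complex set. open U} \<subseteq> Pow UNIV"
    "B \<in> sigma_sets UNIV {U. open U}"
    using assms by (auto simp: sets_borel Int_stable_def)
  then show ?thesis
  proof (induction rule: sigma_sets_induct_disjoint)
    case empty show ?case using const_kaczmarz_multiplier[of 0] by simp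
  next
    case (compl B)
    have "(\<lambda>y. 1 + (-1) * indicator B (chr 1 y)) \<in> kaczmarz_multiplier"
      by (intro kaczmarz_multiplier_add kaczmarz_multiplier_mult const_kaczmarz_multiplier compl)
    also have "(\<lambda>y. 1 + (-1) * indicator B (chr 1 y)) = (\<lambda>y. indicator (UNIV - B) (chr 1 y) :: complex)"
      by (auto simp: indicator_def)
    finally show ?case .
  next
    case (union A)
    have [measurable]: "A i \<in> sets borel" for i using union(2) by (auto simp: sets_borel)
    show ?case
    proof (rule kaczmarz_multiplier_limit[where s="\<lambda>k y. indicator (\<Union>i<k. A i) (chr 1 y)"])
      have [measurable]: "(\<Union>i. A i) \<in> sets borel" by measurable
      show "(\<lambda>y. indicator (\<Union>i. A i) (chr 1 y)) \<in> borel_measurable borel"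
        by (rule measurable_compose[OF borel_measurable_chr]) measurable
      show "(\<lambda>y. indicator (\<Union>i<k. A i) (chr 1 y)) \<in> kaczmarz_multiplier" for k :: nat
        using kaczmarz_multiplier_sum[of "{..<k}" "\<lambda>i y. indicator (A i) (chr 1 y)"] union(1,3)
        by (subst indicator_UN_disjoint) (auto simp: disjoint_family_on_def)
      show "cmod (indicator (\<Union>i<k. A i) (chr 1 y)) \<le> 1" for k y
        by (auto simp: indicator_def)
    qed (intro AE_I2 LIMSEQ_indicator_UN)
  next
    case (basic U)
    then have [measurable]: "U \<in> sets borel" by auto
    show ?case
    \<comment> \<open>The distance \<open>infdist\<close> to the empty set is 0 by convention, so
      the approximants below would vanish for the whole plane.\<close>
    proof (cases "U = UNIV")
      case True
      then show ?thesis using const_kaczmarz_multiplier[of 1] by simp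
    next
      case False
      then have ne: "- U \<noteq> {}" by auto
      have cl: "closed (- U)" using basic by (simp add: closed_def)
      \<comment> \<open>These continuous functions vanish off \<open>U\<close>, and at each point of
        the open set \<open>U\<close> they are eventually 1.\<close>
      define g where "g k z = min 1 (real k * infdist z (- U))" for k z
      show ?thesis
      proof (rule kaczmarz_multiplier_limit)
        show "(\<lambda>y. indicator U (chr 1 y)) \<in> borel_measurable borel" by measurable
        show "(\<lambda>y. complex_of_real (g k (chr 1 y))) \<in> kaczmarz_multiplier" for k
          unfolding g_def by (intro continuous_multiplier continuous_intros)
        show "cmod (complex_of_real (g k (chr 1 y))) \<le> 1" for k y
          by (simp add: g_def infdist_nonneg)
        have "(\<lambda>k. complex_of_real (g k z)) \<longlonglongrightarrow> indicator U z" for z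
        proof (cases "z \<in> U")
          case True
          then have "infdist z (- U) > 0"
            using in_closed_iff_infdist_zero[OF cl ne, of z] infdist_nonneg[of z "- U"] by auto
          then obtain N where N: "1 < real N * infdist z (- U)"
            using reals_Archimedean3 by blast
          have "complex_of_real (g k z) = 1" if "k \<ge> N" for k
          proof -
            have "real N * infdist z (- U) \<le> real k * infdist z (- U)"
              using that by (intro mult_right_mono infdist_nonneg) auto
            with N show ?thesis by (simp add: g_def)
          qed
          then have "\<forall>\<^sub>F k in sequentially. complex_of_real (g k z) = indicator U z"
            using True by (auto simp: eventually_sequentially)
          then show ?thesis by (rule tendsto_eventually)
        qed (simp add: g_def)
        then show "AE y in M. (\<lambda>k. complex_of_real (g k (chr 1 y))) \<longlonglongrightarrow> indicator U (chr 1 y)"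
          by simp
      qed
    qed
  qed
qed

text \<open>Over \<open>[0,1)\<close> the point \<open>y\<close> is recovered as
  \<open>Arg2pi (chr 1 y) / (2 * pi)\<close>, so almost everywhere the indicator of \<open>B\<close>
  factors through the circle.\<close>

lemma indicator_multiplier:
  assumes [measurable]: "B \<in> sets borel"
  shows "indicator B \<in> kaczmarz_multiplier"
proof (rule kaczmarz_multiplier_cong)
  \<comment> \<open>\<open>Arg2pi\<close> jumps across the positive real axis, but its strict
    superlevel sets are open.\<close>
  have [measurable]: "Arg2pi \<in> borel_measurable borel"
    by (rule borel_measurableI_greater) (simp add: open_Arg2pi2pi_gt)
  define B' where "B' = (\<lambda>z. Arg2pi z / (2 * pi)) -` B"
  have "B' \<in> sets borel"
    unfolding B'_def by (rule measurable_sets_borel[OF _ assms]) measurable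
  then show "(\<lambda>y. indicator B' (chr 1 y)) \<in> kaczmarz_multiplier"
    by (rule indicator_circle_multiplier)
  show "AE y in M. indicator B' (chr 1 y) = (indicator B y :: complex)"
    using AE_unit_interval
    by eventually_elim (auto simp: B'_def Arg2pi_chr indicator_def)
  show "cmod (indicator B y) \<le> 1" for y by (simp add: indicator_def)
qed measurable

text \<open>A simple function is a finite combination of indicators, hence a multiplier; applied to
  the constant 1 it is convergent. Simple approximations then reach \<open>f\<close> by
  closedness.\<close>

lemma L2_subset_kaczmarz_convergent:
  assumes f: "f \<in> L2 M"
  shows "f \<in> kaczmarz_convergent"
proof -
  note [measurable] = L2_measurable[OF f]
  obtain F where F': "\<forall>i. simple_function M (F i)" "\<forall>y\<in>space M. (\<lambda>i. F i y) \<longlonglongrightarrow> f y"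
    "\<forall>i. \<forall>y\<in>space M. dist (F i y) 0 \<le> 2 * dist (f y) 0"
    using borel_measurable_implies_sequence_metric[OF L2_measurable[OF f], of 0] by blast
  have F: "simple_function M (F i)" and lim: "(\<lambda>i. F i y) \<longlonglongrightarrow> f y"
    and bound: "cmod (F i y) \<le> 2 * cmod (f y)" for i y
    using F' by simp_all
  have [measurable]: "F i \<in> borel_measurable M" for i
    using F by (rule borel_measurable_simple_function)
  show ?thesis
  proof (rule kaczmarz_convergent_closed[OF f])
    show "F i \<in> kaczmarz_convergent" for i
    proof -
      have "indicator (F i -` {z}) \<in> kaczmarz_multiplier" for z
      proof (rule indicator_multiplier)
        have "F i -` {z} \<inter> space M \<in> sets M" by (rule simple_functionD(2)[OF F])
        then show "F i -` {z} \<in> sets borel" by (simp add: sets_eq_borel)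
      qed
      then have "(\<lambda>y. indicator (F i -` {z}) y * z) \<in> kaczmarz_multiplier" for z
        by (rule kaczmarz_multiplier_mult[OF _ const_kaczmarz_multiplier])
      then have "(\<lambda>y. \<Sum>z\<in>range (F i). indicator (F i -` {z}) y * z) \<in> kaczmarz_multiplier"
        by (intro kaczmarz_multiplier_sum)
      moreover have "(\<Sum>z\<in>range (F i). indicator (F i -` {z}) y * z) * 1 = F i y" for y
      proof -
        have "F i y = (\<Sum>z\<in>range (F i). indicator (F i -` {z}) y *\<^sub>R z)"
          using simple_function_indicator_representation_banach[OF F, of y i]
          unfolding space_eq_UNIV Int_UNIV_right by blast
        also have "\<dots> = (\<Sum>z\<in>range (F i). indicator (F i -` {z}) y * z)"
          by (intro sum.cong refl) (simp add: indicator_def)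
        finally show ?thesis by (simp only: mult_1_right)
      qed
      ultimately show ?thesis
        by (drule_tac kaczmarz_multiplierD[OF _ one_kaczmarz_convergent]) (simp only:)
    qed
    show "(\<lambda>i. L2_sq M (\<lambda>y. f y - F i y)) \<longlonglongrightarrow> 0"
    proof (rule L2_sq_dominated_convergence)
      \<comment> \<open>The 3 is 1 for \<open>f\<close> plus 2 from the bound on its simple
        approximations.\<close>
      show "(\<lambda>y. 3 * f y) \<in> L2 M" by (rule L2_cmult[OF f])
      show "AE y in M. cmod (f y - F i y) \<le> cmod (3 * f y)" for i
      proof (rule AE_I2)
        fix y
        show "cmod (f y - F i y) \<le> cmod (3 * f y)"
          using norm_triangle_ineq4[of "f y" "F i y"] bound[of i y] by (simp add: norm_mult)
      qed
      show "AE y in M. (\<lambda>i. f y - F i y) \<longlonglongrightarrow> 0"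
      proof (rule AE_I2)
        fix y
        have "(\<lambda>i. f y - F i y) \<longlonglongrightarrow> f y - f y" by (intro tendsto_intros lim)
        then show "(\<lambda>i. f y - F i y) \<longlonglongrightarrow> 0" by simp
      qed
    qed measurable
  qed
qed

end end

section \<open>The Poisson kernel\<close>

text \<open>Normalised arc length on the circle, set up as one more circle measure so that the
  projection and Cauchy transform lemmas apply to it too.\<close>

definition unit_lebesgue :: "real measure" where
  "unit_lebesgue = density lborel (indicator {0..<1})"

lemma sets_unit_lebesgue [simp, measurable_cong]: "sets unit_lebesgue = sets borel"
  by (simp add: unit_lebesgue_def)

lemma AE_unit_lebesgue:
  assumes "{x. P x} \<in> sets borel"
  shows "(AE x in unit_lebesgue. P x) \<longleftrightarrow> (AE x in lborel. x \<in> {0..<1} \<longrightarrow> P x)"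
  unfolding unit_lebesgue_def by (subst AE_density) (auto simp: indicator_def)

lemma circle_measure_unit_lebesgue: "circle_measure unit_lebesgue"
proof -
  interpret prob_space unit_lebesgue
    by (rule prob_spaceI) (simp add: unit_lebesgue_def emeasure_density)
  show ?thesis
    by unfold_locales (simp_all add: AE_unit_lebesgue)
qed

interpretation UL: circle_measure unit_lebesgue
  by (rule circle_measure_unit_lebesgue)

lemma integral_unit_lebesgue_chr:
  "(LINT t|unit_lebesgue. chr n t) = (if n = 0 then 1 else 0)"
proof (cases "n = 0")
  case False
  define c where "c = 2 * of_real pi * \<i> * of_int n"
  have c: "c \<noteq> 0" using False by (simp add: c_def)
  have chr: "chr n t = exp (c * of_real t)" for t
    by (simp add: chr_def cis_conv_exp c_def mult_ac)
  have "(LINT t|unit_lebesgue. chr n t) = (LINT t|lborel. indicator {0..<1} t *\<^sub>R chr n t)"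
    unfolding unit_lebesgue_def ennreal_indicator[symmetric] by (subst integral_density) auto
  also have "\<dots> = (LINT t|lborel. indicator {0..1} t *\<^sub>R chr n t)"
  proof (rule integral_cong_AE)
    show "AE t in lborel. indicator {0..<1} t *\<^sub>R chr n t = indicator {0..1} t *\<^sub>R chr n t"
      using AE_lborel_singleton[of 1] by eventually_elim (auto simp: indicator_def)
  qed auto
  also have "\<dots> = exp (c * of_real 1) / c - exp (c * of_real 0) / c"
  proof (rule integral_FTC_Icc)
    fix t :: real
    have "((\<lambda>z. exp (c * z) / c) has_field_derivative chr n t) (at (of_real t))"
      using c by (auto simp: chr intro!: derivative_eq_intros)
    from has_vector_derivative_real_field[OF this]
    show "((\<lambda>t. exp (c * of_real t) / c) has_vector_derivative chr n t) (at t within {0..1})"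
      by (rule has_vector_derivative_at_within)
  qed (auto intro: continuous_intros)
  also have "\<dots> = 0"
  proof -
    have "exp (c * of_real 1) = chr n 1" by (simp add: chr)
    also have "\<dots> = 1" using cis_multiple_2pi[of "of_int n"] by (simp add: chr_def)
    finally show ?thesis by simp
  qed
  finally show ?thesis using False by simp
qed simp

text \<open>Parseval: by orthogonality the inner product with \<open>chr N\<close> is the top
  coefficient, and the projection lemma peels that term off.\<close>

lemma L2_sq_trig_polynomial:
  "L2_sq unit_lebesgue (\<lambda>t. \<Sum>k<N. u k * chr (int k) t) = (\<Sum>k<N. (cmod (u k))\<^sup>2)"
proof (induction N)
  case 0
  show ?case by (simp add: L2_sq_def)
next
  case (Suc N)
  let ?f = "\<lambda>t. \<Sum>k<Suc N. u k * chr (int k) t"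
  have f: "?f \<in> L2 unit_lebesgue"
    by (intro L2_sum L2_cmult UL.chr_L2)
  have eq: "?f t * cnj (chr (int N) t) = (\<Sum>k<Suc N. u k * chr (int k - int N) t)" for t
    unfolding sum_distrib_right mult.assoc cnj_chr chr_add[symmetric] by simp
  have "(LINT t|unit_lebesgue. ?f t * cnj (chr (int N) t)) =
      (\<Sum>k<Suc N. u k * (LINT t|unit_lebesgue. chr (int k - int N) t))"
    unfolding eq
    by (subst Bochner_Integration.integral_sum)
      (auto intro!: integrable_mult_right UL.integrable_chr)
  also have "\<dots> = u N"
    by (simp add: integral_unit_lebesgue_chr if_distrib[of "(*) _"] cong: if_cong)
  finally have "L2_sq unit_lebesgue (\<lambda>t. ?f t - u N * chr (int N) t) =
      L2_sq unit_lebesgue ?f - (cmod (u N))\<^sup>2"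
    using UL.L2_sq_diff_projection[OF f, of "int N"] by simp
  then show ?case using Suc by simp
qed

text \<open>As \<open>chr 1 y\<close> is unimodular, the denominator is the squared distance from
  \<open>z\<close> to \<open>chr 1 y\<close>; this is the usual Poisson kernel at that boundary
  point.\<close>

definition poisson :: "complex \<Rightarrow> real \<Rightarrow> real" where
  "poisson z y = (1 - (cmod z)\<^sup>2) / (cmod (1 - z * chr (-1) y))\<^sup>2"

text \<open>It serves twice: with \<open>w = z * chr (-1) y\<close> for the Poisson kernel itself,
  and with the inner function as \<open>w\<close> for the Poisson integral of
  \<open>M\<close>.\<close>

lemma Re_inverse_one_minus:
  assumes "w \<noteq> 1"
  shows "2 * Re (1 / (1 - w)) - 1 = (1 - (cmod w)\<^sup>2) / (cmod (1 - w))\<^sup>2"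
proof -
  have pos: "(cmod (1 - w))\<^sup>2 > 0" using assms by simp
  have *: "(2 * (a / D) - 1) * D = 2 * a - D" if "D > 0" for a D :: real
    using that by (simp add: field_simps)
  have re: "Re (1 / (1 - w)) = (1 - Re w) / (cmod (1 - w))\<^sup>2"
    by (simp add: Re_divide cmod_power2)
  have "(2 * Re (1 / (1 - w)) - 1) * (cmod (1 - w))\<^sup>2 = 2 * (1 - Re w) - (cmod (1 - w))\<^sup>2"
    unfolding re by (rule *[OF pos])
  also have "\<dots> = 1 - (cmod w)\<^sup>2"
    by (simp add: cmod_power2) (simp add: power2_eq_square algebra_simps)
  finally show ?thesis using pos by (simp add: eq_divide_eq)
qed

lemma one_minus_mult_chr:
  assumes "cmod z < 1"
  shows "z * chr n y \<noteq> 1" "1 - cmod z \<le> cmod (1 - z * chr n y)"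
proof -
  show "1 - cmod z \<le> cmod (1 - z * chr n y)"
    using norm_triangle_ineq2[of 1 "z * chr n y"] by (simp add: norm_mult)
  then show "z * chr n y \<noteq> 1" using assms by auto
qed

lemma poisson_eq_Re:
  "cmod z < 1 \<Longrightarrow> poisson z y = 2 * Re (1 / (1 - z * chr (-1) y)) - 1"
  using Re_inverse_one_minus[of "z * chr (-1) y"] one_minus_mult_chr[of z "-1" y]
  by (simp add: poisson_def norm_mult)

lemma poisson_nonneg: "cmod z < 1 \<Longrightarrow> 0 \<le> poisson z y"
  by (auto simp: poisson_def power_le_one intro!: divide_nonneg_nonneg)

text \<open>The two denominators are moduli of complex conjugates. This turns an average over the
  base point \<open>\<theta>\<close> into an average over the boundary variable.\<close>

lemma poisson_swap:
  "poisson (of_real r * chr 1 \<theta>) y = poisson (of_real r * chr 1 y) \<theta>"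
proof -
  have "cnj (1 - of_real r * chr 1 \<theta> * chr (-1) y) = 1 - of_real r * chr 1 y * chr (-1) \<theta>"
    by simp
  then have "cmod (1 - of_real r * chr 1 \<theta> * chr (-1) y) = cmod (1 - of_real r * chr 1 y * chr (-1) \<theta>)"
    by (metis complex_mod_cnj)
  then show ?thesis by (simp add: poisson_def norm_mult)
qed

lemma poisson_measurable [measurable]:
  "(\<lambda>(z, y). poisson z y) \<in> borel_measurable (borel \<Otimes>\<^sub>M borel)"
  unfolding poisson_def by measurable

lemma poisson_le:
  assumes z: "cmod z < 1"
  shows "poisson z y \<le> 1 / (1 - cmod z)\<^sup>2"
proof -
  have "(1 - cmod z)\<^sup>2 \<le> (cmod (1 - z * chr (-1) y))\<^sup>2"
    using one_minus_mult_chr[OF z] z by (intro power_mono) auto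
  then show ?thesis
    unfolding poisson_def using z by (intro frac_le) auto
qed

text \<open>
  The factor 4 comes from \<open>\<bar>1 - e\<bar> \<le> \<bar>1 - r e\<bar> + (1 - r) \<le> 2 \<bar>1 - r e\<bar>\<close> for \<open>\<bar>e\<bar> = 1\<close>.
\<close>

lemma poisson_le_away:
  assumes r: "0 \<le> r" "r < 1" and d: "0 < d" "d \<le> cmod (1 - chr 1 \<theta> * chr (-1) y)"
  shows "poisson (of_real r * chr 1 \<theta>) y \<le> 4 * (1 - r\<^sup>2) / d\<^sup>2"
proof -
  let ?e = "chr 1 \<theta> * chr (-1) y"
  have r': "cmod (of_real r * chr 1 \<theta>) = r" using r by (simp add: norm_mult)
  have le: "1 - r \<le> cmod (1 - of_real r * ?e)"
    using one_minus_mult_chr(2)[of "of_real r * chr 1 \<theta>" "-1" y] r r' by (simp add: mult.assoc)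
  have "cmod (1 - ?e) = cmod ((1 - of_real r * ?e) + of_real (r - 1) * ?e)"
    by (rule arg_cong[where f=cmod]) (simp add: algebra_simps)
  also have "\<dots> \<le> cmod (1 - of_real r * ?e) + cmod (of_real (r - 1) * ?e)"
    by (rule norm_triangle_ineq)
  also have "cmod (of_real (r - 1) * ?e) = 1 - r"
    using r by (simp only: norm_mult norm_of_real norm_chr) simp
  finally have "d / 2 \<le> cmod (1 - of_real r * ?e)"
    using le d by linarith
  then have "(d / 2)\<^sup>2 \<le> (cmod (1 - of_real r * ?e))\<^sup>2"
    using d by (intro power_mono) auto
  then have "(1 - r\<^sup>2) / (cmod (1 - of_real r * ?e))\<^sup>2 \<le> (1 - r\<^sup>2) / (d / 2)\<^sup>2"
    using d r by (intro divide_left_mono) (auto simp: power_le_one intro!: mult_pos_pos)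
  also have "\<dots> = 4 * (1 - r\<^sup>2) / d\<^sup>2" by (simp add: power_divide)
  finally show ?thesis
    unfolding poisson_def r' by (simp add: mult.assoc)
qed

section \<open>Cauchy transforms and Poisson integrals of circle measures\<close>

context circle_measure
begin

text \<open>The geometric series in \<open>z * chr (-1) y\<close> is integrated term by term; its
  partial sums are dominated by \<open>1 / (1 - cmod z)\<close>.\<close>

lemma cauchy_transform_sums:
  assumes z: "cmod z < 1"
  shows "(\<lambda>k. (LINT y|M. chr (- int k) y) * z ^ k) sums (LINT y|M. 1 / (1 - z * chr (-1) y))"
proof -
  let ?w = "\<lambda>y. z * chr (-1) y"
  have w: "cmod (?w y) < 1" for y using z by (simp add: norm_mult)
  have "(\<lambda>N. LINT y|M. (\<Sum>k<N. ?w y ^ k)) \<longlonglongrightarrow> (LINT y|M. 1 / (1 - ?w y))"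
  proof (rule integral_dominated_convergence[where w="\<lambda>y. 1 / (1 - cmod z)"])
    show "AE y in M. (\<lambda>N. \<Sum>k<N. ?w y ^ k) \<longlonglongrightarrow> 1 / (1 - ?w y)"
      using geometric_sums[OF w] by (simp add: sums_def)
    show "AE y in M. norm (\<Sum>k<N. ?w y ^ k) \<le> 1 / (1 - cmod z)" for N
    proof (rule AE_I2)
      fix y
      have "norm (\<Sum>k<N. ?w y ^ k) \<le> (\<Sum>k<N. cmod z ^ k)"
        by (rule order_trans[OF norm_sum]) (simp add: norm_mult norm_power)
      also have "\<dots> \<le> (\<Sum>k. cmod z ^ k)"
        using z by (intro sum_le_suminf summable_geometric) auto
      also have "\<dots> = 1 / (1 - cmod z)" using z by (intro suminf_geometric) simp
      finally show "norm (\<Sum>k<N. ?w y ^ k) \<le> 1 / (1 - cmod z)" .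
    qed
  qed auto
  moreover have "(LINT y|M. (\<Sum>k<N. ?w y ^ k)) = (\<Sum>k<N. (LINT y|M. chr (- int k) y) * z ^ k)" for N
  proof -
    have "?w y ^ k = chr (- int k) y * z ^ k" for y k
      by (simp add: power_mult_distrib chr_power)
    then show ?thesis by simp
  qed
  ultimately show ?thesis by (simp add: sums_def)
qed

lemma integrable_cauchy_kernel:
  assumes z: "cmod z < 1"
  shows "integrable M (\<lambda>y. 1 / (1 - z * chr (-1) y))"
proof (rule integrable_const_bound[where B="1 / (1 - cmod z)"])
  show "AE y in M. cmod (1 / (1 - z * chr (-1) y)) \<le> 1 / (1 - cmod z)"
    using one_minus_mult_chr(2)[OF z] z by (auto simp: norm_divide intro!: frac_le)
qed measurable

lemma poisson_integral:
  assumes z: "cmod z < 1"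
  shows "integrable M (poisson z)"
    and "(LINT y|M. poisson z y) = 2 * Re (LINT y|M. 1 / (1 - z * chr (-1) y)) - 1"
proof -
  note i = integrable_cauchy_kernel[OF z]
  have eq: "poisson z = (\<lambda>y. 2 * Re (1 / (1 - z * chr (-1) y)) - 1)"
    using poisson_eq_Re[OF z] by auto
  have *: "integrable M (\<lambda>y. Re (1 / (1 - z * chr (-1) y)))"
    by (rule integrable_Re[OF i])
  then show "integrable M (poisson z)" unfolding eq by simp
  show "(LINT y|M. poisson z y) = 2 * Re (LINT y|M. 1 / (1 - z * chr (-1) y)) - 1"
    unfolding eq integral_Re[OF i, symmetric] using * by simp
qed

end

text \<open>Orthogonality leaves only the constant Taylor coefficient, so the Cauchy transform of
  \<open>unit_lebesgue\<close> is 1.\<close>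

lemma integral_unit_lebesgue_poisson:
  assumes z: "cmod z < 1"
  shows "(LINT t|unit_lebesgue. poisson z t) = 1"
proof -
  have "(\<lambda>k. (LINT y|unit_lebesgue. chr (- int k) y) * z ^ k) sums 1"
    using sums_single[of 0 "\<lambda>k. 1 :: complex"]
    by (simp add: integral_unit_lebesgue_chr if_distrib[of "\<lambda>x. x * _"] cong: if_cong)
  from sums_unique2[OF UL.cauchy_transform_sums[OF z] this] show ?thesis
    by (simp add: UL.poisson_integral[OF z])
qed

lemma chr_mult_eq_1_imp_eq:
  assumes "x \<in> {0..<1}" "y \<in> {0..<1}" "chr 1 x * chr (-1) y = 1"
  shows "x = y"
proof -
  have "chr 1 x = chr 1 x * (chr (-1) y * chr 1 y)" by (simp only: chr_mult_chr_minus mult_1_right)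
  also have "\<dots> = (chr 1 x * chr (-1) y) * chr 1 y" by (simp only: mult.assoc)
  also have "\<dots> = chr 1 y" unfolding assms(3) by simp
  finally have "Arg2pi (chr 1 x) = Arg2pi (chr 1 y)" by (rule arg_cong)
  then show ?thesis unfolding Arg2pi_chr[OF assms(1)] Arg2pi_chr[OF assms(2)] by simp
qed

section \<open>Vanishing of Poisson integrals of singular measures at the circle\<close>

locale singular_circle_measure = circle_measure +
  assumes singular: "singular_wrt M lborel"
begin

text \<open>Inner regularity, applied to a null carrier of \<open>M\<close> cut down to
  \<open>[0,1)\<close>. Compactness will keep each point outside \<open>K\<close> at a positive
  distance from it.\<close>

lemma obtain_compact_null:
  assumes "\<epsilon> > 0"
  obtains K where "compact K" "K \<subseteq> {0..<1}" "K \<in> null_sets lborel" "measure M (- K) < \<epsilon>"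
proof -
  obtain A where A: "A \<in> sets M" "emeasure lborel A = 0" "emeasure M (space M - A) = 0"
    using singular by (auto simp: singular_wrt_def supported_on_def)
  have [measurable]: "A \<in> sets borel" using A sets_eq_borel by simp
  let ?B = "A \<inter> {0..<1}"
  have "AE y in M. y \<notin> space M - A"
    by (rule AE_not_in) (use A sets.compl_sets[OF A(1)] in \<open>auto simp: null_sets_def\<close>)
  with AE_unit_interval have "AE y in M. y \<in> ?B" by eventually_elim auto
  moreover have B: "?B \<in> sets M" by (simp add: sets_eq_borel)
  ultimately have "emeasure M ?B = 1" by (simp add: emeasure_eq_1_AE)
  moreover have "emeasure M ?B = (SUP K \<in> {K. K \<subseteq> ?B \<and> compact K}. emeasure M K)"
    by (rule inner_regular) (use B sets_eq_borel in auto)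
  ultimately have "ennreal (1 - \<epsilon>) < (SUP K \<in> {K. K \<subseteq> ?B \<and> compact K}. emeasure M K)"
    using assms by (simp add: ennreal_less_one_iff)
  then obtain K where K: "K \<subseteq> ?B" "compact K" "ennreal (1 - \<epsilon>) < emeasure M K"
    by (auto simp: less_SUP_iff)
  have KM: "K \<in> sets M" using K by (simp add: sets_eq_borel borel_compact)
  have "1 - \<epsilon> < measure M K"
    using K(3) ennreal_leI[of "measure M K" "1 - \<epsilon>"]
    by (auto simp: emeasure_eq_measure not_le[symmetric])
  moreover have "measure M (- K) = 1 - measure M K"
    using prob_compl[OF KM] by (simp add: Compl_eq_Diff_UNIV)
  ultimately have "measure M (- K) < \<epsilon>" by simp
  moreover have "K \<in> null_sets lborel"
  proof (rule null_sets_subset[of A])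
    show "A \<in> null_sets lborel" using A(2) by (simp add: null_sets_def)
    show "K \<in> sets lborel" using KM sets_eq_borel by simp
  qed (use K in blast)
  ultimately show ?thesis using K that by blast
qed

lemma poisson_integrable_product:
  assumes r: "0 \<le> r" "r < 1" and [measurable]: "A \<in> sets borel"
  shows "integrable (unit_lebesgue \<Otimes>\<^sub>M M)
    (\<lambda>(\<theta>, y). indicator A y * poisson (of_real r * chr 1 \<theta>) y)"
proof -
  interpret P: pair_prob_space unit_lebesgue M ..
  note [measurable_cong] = sets_eq_borel
  have n: "cmod (of_real r * chr 1 \<theta>) = r" for \<theta> using r by (simp add: norm_mult)
  show ?thesis
  proof (rule P.integrable_const_bound[where B="1 / (1 - r)\<^sup>2"])
    have "norm (indicator A y * poisson (of_real r * chr 1 \<theta>) y) \<le> 1 / (1 - r)\<^sup>2" for \<theta> y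
      using poisson_le[of "of_real r * chr 1 \<theta>" y] poisson_nonneg[of "of_real r * chr 1 \<theta>" y] r
      by (simp add: n indicator_def)
    then show "AE x in unit_lebesgue \<Otimes>\<^sub>M M. norm (case x of (\<theta>, y) \<Rightarrow>
        indicator A y * poisson (of_real r * chr 1 \<theta>) y) \<le> 1 / (1 - r)\<^sup>2"
      by (intro AE_I2) (simp only: split_beta)
  qed measurable
qed

text \<open>After Fubini and \<open>poisson_swap\<close> the integral over \<open>\<theta>\<close>
  is 1 for every \<open>y\<close>. The value does not depend on \<open>r\<close>, so a small
  leftover mass stays harmless at every radius.\<close>

lemma integral_poisson_part:
  assumes r: "0 \<le> r" "r < 1" and [measurable]: "A \<in> sets borel"
  shows "integrable unit_lebesgue (\<lambda>\<theta>. LINT y|M. indicator A y * poisson (of_real r * chr 1 \<theta>) y)"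
    and "(LINT \<theta>|unit_lebesgue. LINT y|M. indicator A y * poisson (of_real r * chr 1 \<theta>) y)
      = measure M A"
proof -
  interpret P: pair_prob_space unit_lebesgue M ..
  note i = poisson_integrable_product[OF assms]
  show "integrable unit_lebesgue (\<lambda>\<theta>. LINT y|M. indicator A y * poisson (of_real r * chr 1 \<theta>) y)"
    using P.integrable_fst[OF i] by simp
  have "(LINT \<theta>|unit_lebesgue. LINT y|M. indicator A y * poisson (of_real r * chr 1 \<theta>) y) =
      (LINT y|M. LINT \<theta>|unit_lebesgue. indicator A y * poisson (of_real r * chr 1 \<theta>) y)"
    using P.Fubini_integral[OF i] by simp
  also have "\<dots> = (LINT y|M. indicator A y)"
    using r by (simp add: poisson_swap[of r] integral_unit_lebesgue_poisson norm_mult)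
  also have "\<dots> = measure M A" by (simp add: sets_eq_borel)
  finally show "(LINT \<theta>|unit_lebesgue. LINT y|M. indicator A y * poisson (of_real r * chr 1 \<theta>) y)
      = measure M A" .
qed

text \<open>The chord distance from \<open>\<theta>\<close> to the compact \<open>K\<close> has a
  positive lower bound \<open>d\<close>, so \<open>poisson_le_away\<close> bounds the kernel on
  \<open>K\<close> by a multiple of \<open>1 - (r j)\<^sup>2\<close>.\<close>

lemma poisson_compact_tendsto_0:
  assumes K: "compact K" "K \<subseteq> {0..<1}" and \<theta>: "\<theta> \<in> {0..<1} - K"
    and r: "\<And>j. 0 \<le> r j" "\<And>j. r j < 1" "r \<longlonglongrightarrow> 1"
  shows "(\<lambda>j. LINT y|M. indicator K y * poisson (of_real (r j) * chr 1 \<theta>) y) \<longlonglongrightarrow> 0"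
proof -
  have n: "cmod (of_real (r j) * chr 1 \<theta>) < 1" for j
    using r by (simp add: norm_mult)
  obtain d where d: "d > 0" "\<And>y. y \<in> K \<Longrightarrow> d \<le> cmod (1 - chr 1 \<theta> * chr (-1) y)"
  proof (cases "K = {}")
    case True
    then show ?thesis using that[of 1] by auto
  next
    case False
    have "continuous_on K (\<lambda>y. cmod (1 - chr 1 \<theta> * chr (-1) y))"
      by (intro continuous_intros)
    from continuous_attains_inf[OF K(1) False this] obtain y0 where y0: "y0 \<in> K"
      "\<And>y. y \<in> K \<Longrightarrow> cmod (1 - chr 1 \<theta> * chr (-1) y0) \<le> cmod (1 - chr 1 \<theta> * chr (-1) y)"
      by blast
    \<comment> \<open>\<open>chr 1\<close> is injective on \<open>[0,1)\<close>; with the endpoint 1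
      included, 0 and 1 would be the same point of the circle.\<close>
    have "chr 1 \<theta> * chr (-1) y0 \<noteq> 1"
      using chr_mult_eq_1_imp_eq[of \<theta> y0] \<theta> y0(1) K(2) by blast
    then show ?thesis using that[of "cmod (1 - chr 1 \<theta> * chr (-1) y0)"] y0 by simp
  qed
  have [measurable]: "K \<in> sets M" using K by (simp add: sets_eq_borel borel_compact)
  have le: "indicator K y * poisson (of_real (r j) * chr 1 \<theta>) y \<le> 4 * (1 - (r j)\<^sup>2) / d\<^sup>2" for j y
  proof (cases "y \<in> K")
    case True
    then show ?thesis using poisson_le_away[OF r(1,2) d(1) d(2)] by simp
  next
    case False
    then show ?thesis using r(1)[of j] r(2)[of j] by (simp add: power_le_one)
  qed
  have nonneg: "0 \<le> indicator K y * poisson (of_real (r j) * chr 1 \<theta>) y" for j y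
    using poisson_nonneg[OF n] by simp
  have "(\<lambda>j. 4 * (1 - (r j)\<^sup>2) / d\<^sup>2) \<longlonglongrightarrow> 4 * (1 - 1\<^sup>2) / d\<^sup>2"
    using d(1) by (intro tendsto_intros r(3)) simp
  then have lim: "(\<lambda>j. 4 * (1 - (r j)\<^sup>2) / d\<^sup>2) \<longlonglongrightarrow> 0" by simp
  show ?thesis
  proof (rule tendsto_sandwich[OF _ _ tendsto_const lim])
    have "integrable M (\<lambda>y. indicator K y * poisson (of_real (r j) * chr 1 \<theta>) y)" for j
      using integrable_real_mult_indicator[of K M, OF _ poisson_integral(1)[OF n]]
      by (simp add: mult.commute)
    then have "(LINT y|M. indicator K y * poisson (of_real (r j) * chr 1 \<theta>) y) \<le>
        (LINT y|M. 4 * (1 - (r j)\<^sup>2) / d\<^sup>2)" for j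
      using le by (intro integral_mono) auto
    then show "\<forall>\<^sub>F j in sequentially. (LINT y|M. indicator K y * poisson (of_real (r j) * chr 1 \<theta>) y)
        \<le> 4 * (1 - (r j)\<^sup>2) / d\<^sup>2" by simp
  qed (use nonneg in simp)
qed

text \<open>This is convergence to 0 in measure, phrased by truncation at 1. On a compact null set
  \<open>K\<close> of mass above \<open>1 - \<epsilon>' / 4\<close> the integrals tend to 0 almost
  everywhere, with 1 as dominating function; the part off \<open>K\<close> contributes
  \<open>4 * measure M (- K) < \<epsilon>'\<close> at every radius.\<close>

lemma min_poisson_tendsto_0:
  assumes r: "\<And>j. 0 \<le> r j" "\<And>j. r j < 1" "r \<longlonglongrightarrow> 1"
    and bound: "\<And>j. \<delta> \<le> (LINT \<theta>|unit_lebesgue.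
      min 1 (4 * (LINT y|M. poisson (of_real (r j) * chr 1 \<theta>) y)))"
  shows "\<delta> \<le> 0"
proof (rule field_le_epsilon)
  fix \<epsilon>' :: real assume "\<epsilon>' > 0"
  then have "\<epsilon>' / 4 > 0" by simp
  then obtain K where K: "compact K" "K \<subseteq> {0..<1}" "K \<in> null_sets lborel" "measure M (- K) < \<epsilon>' / 4"
    using obtain_compact_null by blast
  define Q where "Q A j \<theta> = (LINT y|M. indicator A y * poisson (of_real (r j) * chr 1 \<theta>) y)" for A j \<theta>
  have Kb [measurable]: "K \<in> sets borel" "- K \<in> sets borel" using K by (auto intro: borel_comp borel_compact)
  note Q = integral_poisson_part[OF r(1,2), folded Q_def]
  have n: "cmod (of_real (r j) * chr 1 \<theta>) < 1" for j \<theta>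
    using r by (simp add: norm_mult)
  have Qnonneg: "0 \<le> Q A j \<theta>" for A j \<theta>
    unfolding Q_def using poisson_nonneg[OF n] by (intro Bochner_Integration.integral_nonneg) simp
  have split: "(LINT y|M. poisson (of_real (r j) * chr 1 \<theta>) y) = Q K j \<theta> + Q (- K) j \<theta>" for j \<theta>
  proof -
    have i: "integrable M (\<lambda>y. indicator A y * poisson (of_real (r j) * chr 1 \<theta>) y)"
      if "A \<in> sets borel" for A
      using integrable_real_mult_indicator[of A M, OF _ poisson_integral(1)[OF n]] that
      by (simp add: sets_eq_borel mult.commute)
    have "poisson z y = indicator K y * poisson z y + indicator (- K) y * poisson z y" for z y
      by (simp add: indicator_def)
    then show ?thesis
      unfolding Q_def using i Kb by (subst Bochner_Integration.integral_add[symmetric]) auto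
  qed
  have int: "integrable unit_lebesgue (\<lambda>\<theta>. min 1 (4 * Q A j \<theta>))" if "A \<in> sets borel" for A j
    using Q(1)[OF that] by (intro integrable_min) auto
  have "(LINT \<theta>|unit_lebesgue. min 1 (4 * (LINT y|M. poisson (of_real (r j) * chr 1 \<theta>) y)))
      \<le> (LINT \<theta>|unit_lebesgue. min 1 (4 * Q K j \<theta>)) + \<epsilon>'" for j
  proof -
    have "(LINT \<theta>|unit_lebesgue. min 1 (4 * (LINT y|M. poisson (of_real (r j) * chr 1 \<theta>) y)))
        \<le> (LINT \<theta>|unit_lebesgue. min 1 (4 * Q K j \<theta>) + 4 * Q (- K) j \<theta>)"
    proof (rule integral_mono)
      show "integrable unit_lebesgue (\<lambda>\<theta>. min 1 (4 * (LINT y|M. poisson (of_real (r j) * chr 1 \<theta>) y)))"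
        unfolding split using Q(1)[of K] Q(1)[of "-K"] Kb by (intro integrable_min) auto
      show "integrable unit_lebesgue (\<lambda>\<theta>. min 1 (4 * Q K j \<theta>) + 4 * Q (- K) j \<theta>)"
        using int[of K] Q(1)[of "-K"] Kb by auto
      show "min 1 (4 * (LINT y|M. poisson (of_real (r j) * chr 1 \<theta>) y)) \<le>
          min 1 (4 * Q K j \<theta>) + 4 * Q (- K) j \<theta>" for \<theta>
        unfolding split using Qnonneg[of "-K" j \<theta>] by (auto simp: min_def)
    qed
    also have "\<dots> = (LINT \<theta>|unit_lebesgue. min 1 (4 * Q K j \<theta>)) + 4 * measure M (- K)"
      using int[of K] Q[of "-K"] Kb by simp
    finally show ?thesis using K(4) by linarith
  qed
  then have "\<delta> \<le> (LINT \<theta>|unit_lebesgue. min 1 (4 * Q K j \<theta>)) + \<epsilon>'" for j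
    using bound[of j] order_trans by blast
  moreover have "(\<lambda>j. (LINT \<theta>|unit_lebesgue. min 1 (4 * Q K j \<theta>)) + \<epsilon>') \<longlonglongrightarrow> 0 + \<epsilon>'"
  proof (intro tendsto_add tendsto_const)
    have "(\<lambda>j. LINT \<theta>|unit_lebesgue. min 1 (4 * Q K j \<theta>)) \<longlonglongrightarrow> (LINT \<theta>|unit_lebesgue. (0::real))"
    proof (rule integral_dominated_convergence[where w="\<lambda>_. 1"])
      show "AE \<theta> in unit_lebesgue. (\<lambda>j. min 1 (4 * Q K j \<theta>)) \<longlonglongrightarrow> 0"
      proof -
        have "AE \<theta> in unit_lebesgue. \<theta> \<notin> K"
          using AE_not_in[OF K(3)] by (subst AE_unit_lebesgue) auto
        with UL.AE_unit_interval show ?thesis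
        proof eventually_elim
          case (elim \<theta>)
          have "(\<lambda>j. min 1 (4 * Q K j \<theta>)) \<longlonglongrightarrow> min 1 (4 * 0)"
            unfolding Q_def using elim
            by (intro tendsto_intros poisson_compact_tendsto_0 K r) auto
          then show ?case by simp
        qed
      qed
      show "(\<lambda>\<theta>. min 1 (4 * Q K j \<theta>)) \<in> borel_measurable unit_lebesgue" for j
        using int[of K] Kb by (intro borel_measurable_integrable)
      show "AE \<theta> in unit_lebesgue. norm (min 1 (4 * Q K j \<theta>)) \<le> 1" for j
        using Qnonneg[of K j] by (auto simp: min_def)
    qed auto
    then show "(\<lambda>j. LINT \<theta>|unit_lebesgue. min 1 (4 * Q K j \<theta>)) \<longlonglongrightarrow> 0" by simp
  qed
  ultimately show "\<delta> \<le> 0 + \<epsilon>'"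
    by (intro LIMSEQ_le_const) auto
qed

end

section \<open>Convergence for singular measures\<close>

lemma summable_norm_bounded_power:
  assumes "\<And>k. cmod (c k) \<le> 1" "cmod z < 1"
  shows "summable (\<lambda>k. norm (c k * z ^ k))"
proof (rule summable_comparison_test'[where g="\<lambda>k. cmod z ^ k"])
  show "norm (norm (c k * z ^ k)) \<le> cmod z ^ k" for k
    using mult_right_mono[OF assms(1)[of k], of "cmod z ^ k"] by (simp add: norm_mult norm_power)
qed (use assms in simp)

section \<open>The inner function of a circle measure\<close>

context circle_measure
begin

text \<open>The explicit residual makes the definition of the coefficients a triangular linear
  system with the moments of \<open>M\<close> as entries. The term \<open>k = n\<close> is the
  newest coefficient, since the moment of order 0 is 1.\<close>

lemma kaczmarz_coeff_convolution:
  "(\<Sum>k\<le>n. kaczmarz_coeff M (chr (-1)) k * (LINT y|M. chr (- int (n - k)) y))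
    = (LINT y|M. chr (- int (Suc n)) y)"
proof -
  let ?c = "kaczmarz_coeff M (chr (-1))"
  have eq: "kaczmarz_residual M (chr (-1)) n y * cnj (chr (int n) y) =
      chr (- int (Suc n)) y - (\<Sum>k<n. ?c k * chr (- int (n - k)) y)" for y
  proof -
    have "chr (int k) y * chr (- int n) y = chr (- int (n - k)) y" if "k < n" for k
      using that by (simp add: of_nat_diff flip: chr_add)
    then have "(\<Sum>k<n. ?c k * chr (int k) y) * chr (- int n) y = (\<Sum>k<n. ?c k * chr (- int (n - k)) y)"
      unfolding sum_distrib_right mult.assoc by (intro sum.cong) auto
    moreover have "chr (-1) y * chr (- int n) y = chr (- int (Suc n)) y"
      by (simp flip: chr_add)
    ultimately show ?thesis
      by (simp only: kaczmarz_residual_eq cnj_chr left_diff_distrib)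
  qed
  have "?c n = (LINT y|M. chr (- int (Suc n)) y) - (\<Sum>k<n. ?c k * (LINT y|M. chr (- int (n - k)) y))"
    unfolding kaczmarz_coeff_def[of M _ n] eq
    by (subst Bochner_Integration.integral_diff) auto
  then show ?thesis by (simp flip: lessThan_Suc_atMost)
qed

lemma cmod_kaczmarz_coeff_chr_le: "cmod (kaczmarz_coeff M (chr n) k) \<le> 1"
proof -
  have "(cmod (kaczmarz_coeff M (chr n) k))\<^sup>2 \<le> L2_sq M (chr n)"
    using cmod_kaczmarz_coeff_sq_le[OF chr_L2] L2_sq_kaczmarz_le[OF chr_L2] order_trans by blast
  also have "L2_sq M (chr n) = 1\<^sup>2" by (simp add: L2_sq_def)
  finally show ?thesis by (rule power2_le_imp_le) simp
qed

lemma cmod_integral_chr_le: "cmod (LINT y|M. chr n y) \<le> 1"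
  using integral_norm_bound[of M "chr n"] by simp

text \<open>
  With \<open>A\<close> the Cauchy transform of \<open>M\<close>, the convolution identity says \<open>A (1 - b) = 1\<close> for
  \<open>b z = z * (\<Sum>k. c k * z ^ k)\<close>; so \<open>b\<close> is the inner function of Clark theory.
\<close>

lemma one_minus_inner_sq_le:
  fixes z :: complex
  assumes z: "cmod z < 1"
  defines "b \<equiv> z * (\<Sum>k. kaczmarz_coeff M (chr (-1)) k * z ^ k)"
  shows "1 - (cmod b)\<^sup>2 \<le> min 1 (4 * (LINT y|M. poisson z y))"
proof -
  let ?c = "kaczmarz_coeff M (chr (-1))" and ?a = "\<lambda>m. LINT y|M. chr (- int m) y"
  let ?A = "LINT y|M. 1 / (1 - z * chr (-1) y)"
  have A: "(\<lambda>k. ?a k * z ^ k) sums ?A" by (rule cauchy_transform_sums[OF z])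
  \<comment> \<open>By the convolution identity, this Cauchy product has the moments shifted by one
    as coefficients; multiplying by \<open>z\<close> below realigns them with the powers.\<close>
  have "(\<lambda>n. \<Sum>k\<le>n. (?c k * z ^ k) * (?a (n - k) * z ^ (n - k))) sums
      ((\<Sum>k. ?c k * z ^ k) * (\<Sum>k. ?a k * z ^ k))"
    by (intro Cauchy_product_sums summable_norm_bounded_power cmod_kaczmarz_coeff_chr_le
        cmod_integral_chr_le z)
  moreover have "(\<Sum>k\<le>n. (?c k * z ^ k) * (?a (n - k) * z ^ (n - k))) = ?a (Suc n) * z ^ n" for n
  proof -
    have "(\<Sum>k\<le>n. (?c k * z ^ k) * (?a (n - k) * z ^ (n - k))) = (\<Sum>k\<le>n. ?c k * ?a (n - k) * z ^ n)"
    proof (rule sum.cong[OF refl])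
      fix k assume "k \<in> {..n}"
      then have "z ^ n = z ^ k * z ^ (n - k)" by (simp flip: power_add)
      then show "(?c k * z ^ k) * (?a (n - k) * z ^ (n - k)) = ?c k * ?a (n - k) * z ^ n"
        by (simp only: mult_ac)
    qed
    then show ?thesis
      by (simp only: kaczmarz_coeff_convolution flip: sum_distrib_right)
  qed
  ultimately have "(\<lambda>n. ?a (Suc n) * z ^ n) sums ((\<Sum>k. ?c k * z ^ k) * ?A)"
    using sums_unique[OF A] by simp
  then have "(\<lambda>n. z * (?a (Suc n) * z ^ n)) sums (z * ((\<Sum>k. ?c k * z ^ k) * ?A))"
    by (rule sums_mult)
  moreover have "z * (?a (Suc n) * z ^ n) = ?a (Suc n) * z ^ Suc n" for n
    by (simp only: power_Suc mult_ac)
  ultimately have "(\<lambda>n. ?a (Suc n) * z ^ Suc n) sums (b * ?A)"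
    by (simp only: b_def mult.assoc)
  \<comment> \<open>Only the constant term of the Cauchy transform is missing, and it equals
    1.\<close>
  moreover have "(\<lambda>n. ?a (Suc n) * z ^ Suc n) sums (?A - ?a 0 * z ^ 0)"
    using A by (subst sums_Suc_iff) simp
  ultimately have "b * ?A = ?A - 1"
    by (auto dest: sums_unique2)
  then have *: "(1 - b) * ?A = 1" by (simp add: algebra_simps)
  then have b1: "b \<noteq> 1" by auto
  then have "?A = 1 / (1 - b)" using * by (simp add: field_simps)
  then have P: "(LINT y|M. poisson z y) = (1 - (cmod b)\<^sup>2) / (cmod (1 - b))\<^sup>2"
    using Re_inverse_one_minus[OF b1] by (simp add: poisson_integral[OF z])
  have pos: "(cmod (1 - b))\<^sup>2 > 0" using b1 by simp
  have P0: "0 \<le> (LINT y|M. poisson z y)"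
    using poisson_nonneg[OF z] by (intro Bochner_Integration.integral_nonneg) simp
  have eq: "1 - (cmod b)\<^sup>2 = (LINT y|M. poisson z y) * (cmod (1 - b))\<^sup>2"
    unfolding P using pos by simp
  \<comment> \<open>A nonnegative Poisson integral forces \<open>cmod b \<le> 1\<close>; then
    \<open>cmod (1 - b) \<le> 2\<close>, whose square is the factor 4.\<close>
  then have "0 \<le> 1 - (cmod b)\<^sup>2" using P0 by simp
  then have "(cmod b)\<^sup>2 \<le> 1\<^sup>2" by simp
  then have "cmod b \<le> 1" by (rule power2_le_imp_le) simp
  then have "cmod (1 - b) \<le> 2" using norm_triangle_ineq4[of 1 b] by simp
  then have "(cmod (1 - b))\<^sup>2 \<le> 2\<^sup>2" by (intro power_mono) auto
  then have "1 - (cmod b)\<^sup>2 \<le> (LINT y|M. poisson z y) * 4"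
    unfolding eq using P0 by (intro mult_left_mono) auto
  then show ?thesis by simp
qed

end

text \<open>Parseval bounds the partial sums, whose coefficients are damped by
  \<open>r ^ k \<le> 1\<close>; dominated convergence with the constant bound
  \<open>1 / (1 - r)\<close> passes to \<open>F\<close>.\<close>

lemma integral_power_series_circle_le:
  fixes c :: "nat \<Rightarrow> complex"
  assumes c: "\<And>k. cmod (c k) \<le> 1" and s: "\<And>N. (\<Sum>k<N. (cmod (c k))\<^sup>2) \<le> s"
    and r: "0 \<le> r" "r < 1"
  defines "F \<equiv> \<lambda>\<theta>. \<Sum>k. c k * (of_real r * chr 1 \<theta>) ^ k"
  shows "integrable unit_lebesgue (\<lambda>\<theta>. (cmod (F \<theta>))\<^sup>2)"
    and "(LINT \<theta>|unit_lebesgue. (cmod (F \<theta>))\<^sup>2) \<le> s"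
proof -
  let ?S = "\<lambda>N \<theta>. \<Sum>k<N. c k * (of_real r * chr 1 \<theta>) ^ k"
  have n: "cmod (of_real r * chr 1 \<theta>) = r" for \<theta> using r by (simp add: norm_mult)
  have S: "?S N \<theta> = (\<Sum>k<N. (c k * of_real r ^ k) * chr (int k) \<theta>)" for N \<theta>
    by (simp add: power_mult_distrib chr_power mult_ac)
  have lim: "(\<lambda>N. ?S N \<theta>) \<longlonglongrightarrow> F \<theta>" for \<theta>
    unfolding F_def using r n c
    by (intro summable_LIMSEQ summable_norm_cancel[OF summable_norm_bounded_power]) auto
  have bound: "cmod (?S N \<theta>) \<le> 1 / (1 - r)" for N \<theta>
  proof -
    have "cmod (?S N \<theta>) \<le> (\<Sum>k<N. r ^ k)"
    proof (rule order_trans[OF norm_sum], rule sum_mono)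
      fix k
      show "cmod (c k * (of_real r * chr 1 \<theta>) ^ k) \<le> r ^ k"
        using mult_right_mono[OF c[of k], of "r ^ k"] r by (simp only: norm_mult norm_power n) simp
    qed
    also have "\<dots> \<le> (\<Sum>k. r ^ k)"
      using r by (intro sum_le_suminf summable_geometric) auto
    also have "\<dots> = 1 / (1 - r)" using r by (intro suminf_geometric) simp
    finally show ?thesis .
  qed
  have [measurable]: "?S N \<in> borel_measurable borel" for N by measurable
  have [measurable]: "F \<in> borel_measurable borel"
    by (rule borel_measurable_LIMSEQ_metric[of ?S]) (use lim in auto)
  have Fbound: "cmod (F \<theta>) \<le> 1 / (1 - r)" for \<theta>
    by (rule LIMSEQ_le_const2[OF tendsto_norm[OF lim]]) (use bound in auto)
  show "integrable unit_lebesgue (\<lambda>\<theta>. (cmod (F \<theta>))\<^sup>2)"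
    using Fbound by (intro UL.integrable_const_bound[where B="(1 / (1 - r))\<^sup>2"])
      (auto intro!: AE_I2 power_mono)
  have "(\<lambda>N. LINT \<theta>|unit_lebesgue. (cmod (?S N \<theta>))\<^sup>2) \<longlonglongrightarrow> (LINT \<theta>|unit_lebesgue. (cmod (F \<theta>))\<^sup>2)"
  proof (rule integral_dominated_convergence[where w="\<lambda>_. (1 / (1 - r))\<^sup>2"])
    show "AE \<theta> in unit_lebesgue. (\<lambda>N. (cmod (?S N \<theta>))\<^sup>2) \<longlonglongrightarrow> (cmod (F \<theta>))\<^sup>2"
      by (intro AE_I2 tendsto_intros lim)
    show "AE \<theta> in unit_lebesgue. norm ((cmod (?S N \<theta>))\<^sup>2) \<le> (1 / (1 - r))\<^sup>2" for N
      using bound by (intro AE_I2) (simp add: power_mono)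
  qed auto
  moreover have "(LINT \<theta>|unit_lebesgue. (cmod (?S N \<theta>))\<^sup>2) \<le> s" for N
  proof -
    have "(LINT \<theta>|unit_lebesgue. (cmod (?S N \<theta>))\<^sup>2) = (\<Sum>k<N. (cmod (c k * of_real r ^ k))\<^sup>2)"
      using L2_sq_trig_polynomial[where u="\<lambda>k. c k * of_real r ^ k"] by (simp only: S L2_sq_def)
    also have "\<dots> \<le> (\<Sum>k<N. (cmod (c k))\<^sup>2)"
    proof (rule sum_mono)
      fix k
      have "cmod (c k) * r ^ k \<le> cmod (c k) * 1"
        using r by (intro mult_left_mono power_le_one) auto
      then have "cmod (c k * of_real r ^ k) \<le> cmod (c k)"
        using r by (simp add: norm_mult norm_power)
      then show "(cmod (c k * of_real r ^ k))\<^sup>2 \<le> (cmod (c k))\<^sup>2" by (intro power_mono) auto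
    qed
    finally show ?thesis using s[of N] by linarith
  qed
  ultimately show "(LINT \<theta>|unit_lebesgue. (cmod (F \<theta>))\<^sup>2) \<le> s"
    by (intro LIMSEQ_le_const2) auto
qed

context singular_circle_measure
begin

text \<open>Since \<open>chr (-1)\<close> has norm 1, its squared coefficients must be shown to sum
  to \<open>s = 1\<close>. On each circle of radius \<open>r j\<close> the mean of
  \<open>1 - (cmod (F \<theta>))\<^sup>2\<close> is at least \<open>1 - s\<close>, and it is at most
  the mean of the truncated Poisson integral, which forces \<open>1 - s \<le> 0\<close>.\<close>

lemma chr_minus_1_kaczmarz_convergent: "chr (-1) \<in> kaczmarz_convergent"
proof -
  let ?c = "kaczmarz_coeff M (chr (-1))"
  define r where "r j = 1 - 1 / real (Suc j)" for j
  have r: "0 \<le> r j" "r j < 1" for j by (simp_all add: r_def)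
  have "(\<lambda>j. 1 - 1 / real (Suc j)) \<longlonglongrightarrow> 1 - 0"
    by (intro tendsto_intros LIMSEQ_Suc[OF lim_1_over_n])
  then have rlim: "r \<longlonglongrightarrow> 1" by (simp add: r_def[abs_def])
  have N1: "L2_sq M (chr (-1)) = 1" by (simp add: L2_sq_def)
  have le1: "(\<Sum>k<N. (cmod (?c k))\<^sup>2) \<le> 1" for N
    using L2_sq_kaczmarz[OF chr_L2, of "-1" N] L2_sq_nonneg[of M "kaczmarz_residual M (chr (-1)) N"] N1
    by linarith
  have sm: "summable (\<lambda>k. (cmod (?c k))\<^sup>2)"
    by (rule summableI_nonneg_bounded[OF _ le1]) simp
  define s where "s = (\<Sum>k. (cmod (?c k))\<^sup>2)"
  have les: "(\<Sum>k<N. (cmod (?c k))\<^sup>2) \<le> s" for N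
    unfolding s_def by (rule sum_le_suminf[OF sm]) auto
  have "1 - s \<le> 0"
  proof (rule min_poisson_tendsto_0[OF r rlim])
    fix j
    let ?z = "\<lambda>\<theta>. of_real (r j) * chr 1 \<theta>"
    let ?F = "\<lambda>\<theta>. \<Sum>k. ?c k * ?z \<theta> ^ k"
    have n: "cmod (?z \<theta>) = r j" for \<theta> using r[of j] by (simp add: norm_mult)
    have n1: "cmod (?z \<theta>) < 1" for \<theta> using n[of \<theta>] r(2)[of j] by simp
    note F = integral_power_series_circle_le[OF cmod_kaczmarz_coeff_chr_le les r]
    have "1 - s \<le> (LINT \<theta>|unit_lebesgue. 1 - (cmod (?F \<theta>))\<^sup>2)"
      using F[of j] by simp
    also have "\<dots> \<le> (LINT \<theta>|unit_lebesgue. min 1 (4 * (LINT y|M. poisson (?z \<theta>) y)))"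
    proof (rule integral_mono)
      show "integrable unit_lebesgue (\<lambda>\<theta>. 1 - (cmod (?F \<theta>))\<^sup>2)"
        using F(1)[of j] by simp
      have "integrable unit_lebesgue (\<lambda>\<theta>. LINT y|M. poisson (?z \<theta>) y)"
        using integral_poisson_part(1)[OF r, of UNIV j] by simp
      then show "integrable unit_lebesgue (\<lambda>\<theta>. min 1 (4 * (LINT y|M. poisson (?z \<theta>) y)))"
        by (intro integrable_min) auto
      fix \<theta>
      \<comment> \<open>The inner function is \<open>z\<close> times the power series, so its
        modulus is at most that of the series.\<close>
      have "cmod (?z \<theta> * ?F \<theta>) \<le> 1 * cmod (?F \<theta>)"
        unfolding norm_mult[of "?z \<theta>"] using n1[of \<theta>] by (intro mult_right_mono) auto
      then have "(cmod (?z \<theta> * ?F \<theta>))\<^sup>2 \<le> (cmod (?F \<theta>))\<^sup>2"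
        by (intro power_mono) auto
      then show "1 - (cmod (?F \<theta>))\<^sup>2 \<le> min 1 (4 * (LINT y|M. poisson (?z \<theta>) y))"
        using one_minus_inner_sq_le[OF n1[of \<theta>]] by linarith
    qed
    finally show "1 - s \<le> (LINT \<theta>|unit_lebesgue. min 1 (4 * (LINT y|M. poisson (?z \<theta>) y)))" .
  qed
  moreover have lim: "(\<lambda>N. 1 - (\<Sum>k<N. (cmod (?c k))\<^sup>2)) \<longlonglongrightarrow> 1 - s"
    unfolding s_def by (intro tendsto_intros summable_LIMSEQ sm)
  moreover have "0 \<le> 1 - s"
    by (rule LIMSEQ_le_const[OF lim]) (use le1 in auto)
  ultimately have "(\<lambda>N. 1 - (\<Sum>k<N. (cmod (?c k))\<^sup>2)) \<longlonglongrightarrow> 0" by simp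
  then show ?thesis
    using L2_sq_kaczmarz[OF chr_L2] by (simp add: kaczmarz_convergent_def N1)
qed

lemma kaczmarz_effective:
  "f \<in> L2 M \<Longrightarrow> (\<lambda>n. L2_sq M (kaczmarz_residual M f n)) \<longlonglongrightarrow> 0"
  using L2_subset_kaczmarz_convergent[OF chr_minus_1_kaczmarz_convergent]
  by (auto simp: kaczmarz_convergent_def)

end

section \<open>Disintegrated measures on the square\<close>

lemma borel_measurable_chr_snd [measurable]: "(\<lambda>z. chr n (snd z)) \<in> borel_measurable (borel :: (real \<times> real) measure)"
  by (intro borel_measurable_continuous_onI continuous_intros)

locale square_disintegration = prob_space \<mu> for \<mu> :: "(real \<times> real) measure" +
  fixes \<rho> :: "real \<Rightarrow> real measure"
  assumes sets_eq_borel: "sets \<mu> = sets borel"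
    and supp: "supported_on \<mu> ({0..<1} \<times> {0..<1})"
    and disint: "rokhlin_disintegration \<mu> \<rho>"
begin

abbreviation "\<mu>\<^sub>1 \<equiv> x_marginal \<mu>"

lemma borel_measurable_mu_iff: "borel_measurable \<mu> = borel_measurable borel"
  by (rule measurable_cong_sets) (simp_all add: sets_eq_borel)

lemma measurable_fst_borel: "fst \<in> measurable \<mu> borel"
  unfolding borel_measurable_mu_iff
  by (intro borel_measurable_continuous_onI continuous_intros)

lemma circle_measure_marginal: "circle_measure \<mu>\<^sub>1"
proof -
  interpret P: prob_space \<mu>\<^sub>1
    unfolding x_marginal_def by (rule prob_space_distr[OF measurable_fst_borel])
  have "AE z in \<mu>. z \<notin> space \<mu> - {0..<1} \<times> {0..<1}"
    using supp by (intro AE_not_in) (auto simp: supported_on_def null_sets_def)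
  then have "AE z in \<mu>. fst z \<in> {0..<1}"
    using AE_space by eventually_elim auto
  then have "AE x in \<mu>\<^sub>1. x \<in> {0..<1}"
    unfolding x_marginal_def by (subst AE_distr_iff[OF measurable_fst_borel]) auto
  then show ?thesis
    by unfold_locales (simp_all add: x_marginal_def)
qed

sublocale marginal: circle_measure \<mu>\<^sub>1
  by (rule circle_measure_marginal)

lemma circle_measure_fibre:
  assumes "x \<in> {0..<1}"
  shows "circle_measure (\<rho> x)"
proof -
  have *: "prob_space (\<rho> x)" "sets (\<rho> x) = sets borel" "supported_on (\<rho> x) {0..<1}"
    using disint assms by (auto simp: rokhlin_disintegration_def)
  interpret F: prob_space "\<rho> x" by fact
  have "AE y in \<rho> x. y \<notin> space (\<rho> x) - {0..<1}"
  proof (rule AE_not_in)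
    show "space (\<rho> x) - {0..<1} \<in> null_sets (\<rho> x)"
      using *(3) unfolding supported_on_def null_sets_def by blast
  qed
  then have supp: "AE y in \<rho> x. y \<in> {0..<1}"
    using AE_space by eventually_elim auto
  show ?thesis by unfold_locales (fact * supp)+
qed

lemma disintegration_complex:
  fixes h :: "real \<times> real \<Rightarrow> complex"
  assumes "integrable \<mu> h"
  shows "AE x in \<mu>\<^sub>1. integrable (\<rho> x) (\<lambda>y. h (x, y))"
    and "set_integrable \<mu>\<^sub>1 {0..<1} (\<lambda>x. LINT y|\<rho> x. h (x, y))"
    and "(LINT z|\<mu>. h z) = (LINT x:{0..<1}|\<mu>\<^sub>1. (LINT y|\<rho> x. h (x, y)))"
  using disint assms by (auto simp: rokhlin_disintegration_def)

lemma disintegration_real: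
  fixes h :: "real \<times> real \<Rightarrow> real"
  assumes h: "integrable \<mu> h"
  shows "AE x in \<mu>\<^sub>1. integrable (\<rho> x) (\<lambda>y. h (x, y))"
    and "set_integrable \<mu>\<^sub>1 {0..<1} (\<lambda>x. LINT y|\<rho> x. h (x, y))"
    and "(LINT z|\<mu>. h z) = (LINT x:{0..<1}|\<mu>\<^sub>1. (LINT y|\<rho> x. h (x, y)))"
proof -
  have "integrable \<mu> (\<lambda>z. complex_of_real (h z))" using h by simp
  note D = disintegration_complex[OF this]
  show "AE x in \<mu>\<^sub>1. integrable (\<rho> x) (\<lambda>y. h (x, y))"
    using D(1) by (simp add: complex_of_real_integrable_eq)
  have "integrable \<mu>\<^sub>1 (\<lambda>x. complex_of_real (indicator {0..<1} x * (LINT y|\<rho> x. h (x, y))))"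
    using D(2) by (simp add: set_integrable_def scaleR_conv_of_real)
  then show "set_integrable \<mu>\<^sub>1 {0..<1} (\<lambda>x. LINT y|\<rho> x. h (x, y))"
    by (simp only: complex_of_real_integrable_eq set_integrable_def real_scaleR_def)
  have "complex_of_real (LINT z|\<mu>. h z) =
      complex_of_real (LINT x:{0..<1}|\<mu>\<^sub>1. (LINT y|\<rho> x. h (x, y)))"
    using D(3) by (simp add: set_lebesgue_integral_def scaleR_conv_of_real flip: of_real_mult)
  then show "(LINT z|\<mu>. h z) = (LINT x:{0..<1}|\<mu>\<^sub>1. (LINT y|\<rho> x. h (x, y)))"
    by (simp only: of_real_eq_iff)
qed

lemma fibre_L2:
  assumes f: "f \<in> L2 \<mu>"
  shows "AE x in \<mu>\<^sub>1. (\<lambda>y. f (x, y)) \<in> L2 (\<rho> x)"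
  using disintegration_real(1)[OF L2_integrable_sq[OF f]] marginal.AE_unit_interval
proof eventually_elim
  case (elim x)
  interpret F: circle_measure "\<rho> x" by (rule circle_measure_fibre) fact
  have [measurable]: "f \<in> borel_measurable (borel \<Otimes>\<^sub>M borel)"
    using L2_measurable[OF f] by (simp add: borel_measurable_mu_iff borel_prod)
  have "(\<lambda>y. f (x, y)) \<in> borel_measurable (\<rho> x)"
    unfolding F.borel_measurable_M_iff by measurable
  with elim show ?case by (simp add: L2_def)
qed

lemma L2_sq_disintegration:
  assumes f: "f \<in> L2 \<mu>"
  shows "set_integrable \<mu>\<^sub>1 {0..<1} (\<lambda>x. L2_sq (\<rho> x) (\<lambda>y. f (x, y)))"
    and "L2_sq \<mu> f = (LINT x:{0..<1}|\<mu>\<^sub>1. L2_sq (\<rho> x) (\<lambda>y. f (x, y)))"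
  using disintegration_real(2,3)[OF L2_integrable_sq[OF f]] by (simp_all add: L2_sq_def)

text \<open>Multiplication by the unimodular \<open>chr n\<close> in the second variable embeds
  \<open>L2 \<mu>\<^sub>1\<close> isometrically, so expansions of the coefficients carry over to the
  square.\<close>

lemma product_L2:
  assumes u: "u \<in> L2 \<mu>\<^sub>1"
  shows "(\<lambda>(x, y). u x * chr n y) \<in> L2 \<mu>"
    and "L2_sq \<mu> (\<lambda>(x, y). u x * chr n y) = L2_sq \<mu>\<^sub>1 u"
proof -
  have [measurable]: "u \<in> borel_measurable borel"
    using L2_measurable[OF u] by (simp add: marginal.borel_measurable_M_iff)
  have m [measurable]: "(\<lambda>z. u (fst z)) \<in> borel_measurable \<mu>"
    by (rule measurable_compose[OF measurable_fst_borel]) measurable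
  have [measurable]: "(\<lambda>z. chr n (snd z)) \<in> borel_measurable \<mu>"
    by (simp add: borel_measurable_mu_iff)
  have sq: "(\<lambda>x. (cmod (u x))\<^sup>2) \<in> borel_measurable borel" by measurable
  have "integrable \<mu> (\<lambda>z. (cmod (u (fst z)))\<^sup>2)"
    using L2_integrable_sq[OF u] unfolding x_marginal_def
    by (subst (asm) integrable_distr_eq[OF measurable_fst_borel sq])
  then show "(\<lambda>(x, y). u x * chr n y) \<in> L2 \<mu>"
    by (simp add: L2_def split_beta norm_mult)
  show "L2_sq \<mu> (\<lambda>(x, y). u x * chr n y) = L2_sq \<mu>\<^sub>1 u"
    unfolding L2_sq_def x_marginal_def
    by (subst integral_distr[OF measurable_fst_borel sq]) (simp add: split_beta norm_mult)
qed

text \<open>The indicator is there because nothing is assumed about \<open>\<rho> x\<close> for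
  \<open>x\<close> outside \<open>[0,1)\<close>.\<close>

definition fibre_coeff :: "(real \<times> real \<Rightarrow> complex) \<Rightarrow> nat \<Rightarrow> real \<Rightarrow> complex" where
  "fibre_coeff f n x = indicator {0..<1} x * kaczmarz_coeff (\<rho> x) (\<lambda>y. f (x, y)) n"

definition fibre_residual :: "(real \<times> real \<Rightarrow> complex) \<Rightarrow> nat \<Rightarrow> real \<times> real \<Rightarrow> complex" where
  "fibre_residual f n = (\<lambda>(x, y). f (x, y) - (\<Sum>k<n. fibre_coeff f k x * chr (int k) y))"

lemma fibre_residual_eq:
  "x \<in> {0..<1} \<Longrightarrow>
    fibre_residual f n (x, y) = kaczmarz_residual (\<rho> x) (\<lambda>y. f (x, y)) n y"
  by (simp add: fibre_residual_def fibre_coeff_def kaczmarz_residual_eq)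

text \<open>Measurability in \<open>x\<close> comes from the disintegration itself: the coefficient
  is the slice integral of the residual times a conjugate character. So the induction alternates:
  residual \<open>n\<close> in L2 gives coefficient \<open>n\<close> in L2, which gives residual
  \<open>n + 1\<close>. The squared coefficient is bounded by the squared slice norm of the
  residual.\<close>

lemma fibre_coeff_L2_if:
  assumes f: "f \<in> L2 \<mu>" and R: "fibre_residual f n \<in> L2 \<mu>"
  shows "fibre_coeff f n \<in> L2 \<mu>\<^sub>1"
proof -
  \<comment> \<open>A product function whose first factor is the constant
    \<open>chr 0\<close>.\<close>
  have e: "(\<lambda>z. chr (int n) (snd z)) \<in> L2 \<mu>"
    using product_L2(1)[OF marginal.chr_L2[of 0], of "int n"]
    by (simp add: split_beta')
  from disintegration_complex(2)[OF integrable_mult_cnj[OF R e]]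
  have i: "integrable \<mu>\<^sub>1 (\<lambda>x. indicator {0..<1} x *\<^sub>R
      (LINT y|\<rho> x. fibre_residual f n (x, y) * cnj (chr (int n) y)))"
    by (simp add: set_integrable_def)
  have eq: "(\<lambda>x. indicator {0..<1} x *\<^sub>R
      (LINT y|\<rho> x. fibre_residual f n (x, y) * cnj (chr (int n) y))) = fibre_coeff f n"
    by (auto simp: fibre_coeff_def kaczmarz_coeff_def fibre_residual_eq indicator_def simp del: cnj_chr)
  have [measurable]: "fibre_coeff f n \<in> borel_measurable \<mu>\<^sub>1"
    using borel_measurable_integrable[OF i] unfolding eq .
  have "integrable \<mu>\<^sub>1 (\<lambda>x. (cmod (fibre_coeff f n x))\<^sup>2)"
  proof (rule Bochner_Integration.integrable_bound)
    show "integrable \<mu>\<^sub>1 (\<lambda>x. indicator {0..<1} x *\<^sub>R L2_sq (\<rho> x) (\<lambda>y. fibre_residual f n (x, y)))"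
      using L2_sq_disintegration(1)[OF R] by (simp add: set_integrable_def)
    show "AE x in \<mu>\<^sub>1. norm ((cmod (fibre_coeff f n x))\<^sup>2) \<le>
        norm (indicator {0..<1} x *\<^sub>R L2_sq (\<rho> x) (\<lambda>y. fibre_residual f n (x, y)))"
      using fibre_L2[OF f] marginal.AE_unit_interval
    proof eventually_elim
      case (elim x)
      interpret F: circle_measure "\<rho> x" by (rule circle_measure_fibre) fact
      show ?case
        using F.cmod_kaczmarz_coeff_sq_le[OF elim(1), of n] elim(2)
        by (simp add: fibre_coeff_def fibre_residual_eq)
    qed
  qed measurable
  then show ?thesis by (simp add: L2_def)
qed

lemma fibre_residual_L2:
  assumes f: "f \<in> L2 \<mu>"
  shows "fibre_residual f n \<in> L2 \<mu>"
proof (induction n)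
  case 0
  then show ?case using f by (simp add: fibre_residual_def)
next
  case (Suc n)
  have "fibre_residual f (Suc n) =
      (\<lambda>z. fibre_residual f n z - (\<lambda>(x, y). fibre_coeff f n x * chr (int n) y) z)"
    by (auto simp: fibre_residual_def)
  then show ?case
    using L2_diff[OF Suc product_L2(1)[OF fibre_coeff_L2_if[OF f Suc]]] by metis
qed

lemma fibre_coeff_L2: "f \<in> L2 \<mu> \<Longrightarrow> fibre_coeff f n \<in> L2 \<mu>\<^sub>1"
  by (intro fibre_coeff_L2_if fibre_residual_L2)

text \<open>On almost every slice the algorithm converges by \<open>kaczmarz_effective\<close>. The
  squared slice norms of the residuals never exceed those of \<open>f\<close>, which are integrable
  in \<open>x\<close>, so dominated convergence applies.\<close>

lemma fibre_residual_tendsto_0: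
  assumes f: "f \<in> L2 \<mu>" and sing: "AE x in \<mu>\<^sub>1. singular_wrt (\<rho> x) lborel"
  shows "(\<lambda>n. L2_sq \<mu> (fibre_residual f n)) \<longlonglongrightarrow> 0"
proof -
  let ?s = "\<lambda>n x. indicator {0..<1} x *\<^sub>R L2_sq (\<rho> x) (\<lambda>y. fibre_residual f n (x, y))"
  let ?w = "\<lambda>x. indicator {0..<1} x *\<^sub>R L2_sq (\<rho> x) (\<lambda>y. f (x, y))"
  have i: "integrable \<mu>\<^sub>1 (?s n)" for n
    using L2_sq_disintegration(1)[OF fibre_residual_L2[OF f]] by (simp add: set_integrable_def)
  have "(\<lambda>n. integral\<^sup>L \<mu>\<^sub>1 (?s n)) \<longlonglongrightarrow> (LINT x|\<mu>\<^sub>1. (0::real))"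
  proof (rule integral_dominated_convergence)
    show "integrable \<mu>\<^sub>1 ?w"
      using L2_sq_disintegration(1)[OF f] by (simp add: set_integrable_def)
    show "?s n \<in> borel_measurable \<mu>\<^sub>1" for n
      using i by (rule borel_measurable_integrable)
    show "AE x in \<mu>\<^sub>1. norm (?s n x) \<le> ?w x" for n
      using fibre_L2[OF f] marginal.AE_unit_interval
    proof eventually_elim
      case (elim x)
      interpret F: circle_measure "\<rho> x" by (rule circle_measure_fibre) fact
      show ?case
        using F.L2_sq_kaczmarz_le[OF elim(1), of n] elim(2) by (simp add: fibre_residual_eq)
    qed
    show "AE x in \<mu>\<^sub>1. (\<lambda>n. ?s n x) \<longlonglongrightarrow> 0"
      using fibre_L2[OF f] marginal.AE_unit_interval sing
    proof eventually_elim
      case (elim x)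
      interpret F: circle_measure "\<rho> x" by (rule circle_measure_fibre) fact
      interpret F: singular_circle_measure "\<rho> x" by unfold_locales fact
      show ?case
        using F.kaczmarz_effective[OF elim(1)] elim(2) by (simp add: fibre_residual_eq)
    qed
  qed simp
  then show ?thesis
    using L2_sq_disintegration(2)[OF fibre_residual_L2[OF f]]
    by (simp add: set_lebesgue_integral_def)
qed

text \<open>The outer terms are the coefficient functions times \<open>chr n\<close> in
  \<open>y\<close>; each coefficient function is expanded in \<open>x\<close> by the algorithm for
  \<open>\<mu>\<^sub>1\<close>, and the isometry \<open>product_L2\<close> transports that
  expansion.\<close>

lemma fourier_expansion:
  assumes f: "f \<in> L2 \<mu>" and sing1: "singular_wrt \<mu>\<^sub>1 lborel"
    and sing: "AE x in \<mu>\<^sub>1. singular_wrt (\<rho> x) lborel"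
  shows "\<exists>(d :: nat \<Rightarrow> nat \<Rightarrow> complex) (g :: nat \<Rightarrow> real \<times> real \<Rightarrow> complex).
       (\<forall>n. L2_sums \<mu>
          (\<lambda>m (x, y). d n m * exp (2 * of_real pi * \<i> * of_real (real n * y + real m * x))) (g n)) \<and>
       L2_sums \<mu> g f"
proof (intro exI conjI allI)
  interpret marginal: singular_circle_measure \<mu>\<^sub>1 by unfold_locales (rule sing1)
  let ?d = "\<lambda>n m. kaczmarz_coeff \<mu>\<^sub>1 (fibre_coeff f n) m"
  let ?g = "\<lambda>n (x, y). fibre_coeff f n x * chr (int n) y"
  have c: "fibre_coeff f n \<in> L2 \<mu>\<^sub>1" for n by (rule fibre_coeff_L2[OF f])
  show "L2_sums \<mu> ?g f"
  proof (rule L2_sums_I)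
    show "?g n \<in> L2 \<mu>" for n by (rule product_L2(1)[OF c])
    have "(\<lambda>z. f z - (\<Sum>k<N. ?g k z)) = fibre_residual f N" for N
      by (auto simp: fibre_residual_def)
    then show "(\<lambda>N. L2_sq \<mu> (\<lambda>z. f z - (\<Sum>k<N. ?g k z))) \<longlonglongrightarrow> 0"
      using fibre_residual_tendsto_0[OF f sing] by simp
  qed (rule f)
  fix n
  let ?u = "\<lambda>m (x, y). (?d n m * chr (int m) x) * chr (int n) y"
  have u: "(\<lambda>m (x, y). ?d n m * exp (2 * of_real pi * \<i> * of_real (real n * y + real m * x))) = ?u"
    by (auto simp: fun_eq_iff chr_eq_exp exp_add ring_distribs mult_ac)
  show "L2_sums \<mu> (\<lambda>m (x, y). ?d n m * exp (2 * of_real pi * \<i> * of_real (real n * y + real m * x))) (?g n)"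
    unfolding u
  proof (rule L2_sums_I)
    show "?u m \<in> L2 \<mu>" for m by (intro product_L2(1) L2_cmult marginal.chr_L2)
    show "?g n \<in> L2 \<mu>" by (rule product_L2(1)[OF c])
    have "(\<lambda>z. ?g n z - (\<Sum>m<N. ?u m z)) =
        (\<lambda>(x, y). kaczmarz_residual \<mu>\<^sub>1 (fibre_coeff f n) N x * chr (int n) y)" for N
      by (auto simp: kaczmarz_residual_eq left_diff_distrib sum_distrib_right)
    then have "L2_sq \<mu> (\<lambda>z. ?g n z - (\<Sum>m<N. ?u m z)) =
        L2_sq \<mu>\<^sub>1 (kaczmarz_residual \<mu>\<^sub>1 (fibre_coeff f n) N)" for N
      using product_L2(2)[OF marginal.kaczmarz_residual_L2[OF c]] by simp
    then show "(\<lambda>N. L2_sq \<mu> (\<lambda>z. ?g n z - (\<Sum>m<N. ?u m z))) \<longlonglongrightarrow> 0"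
      using marginal.kaczmarz_effective[OF c] by simp
  qed
qed

end

section \<open>Null sets of small Hausdorff dimension\<close>

lemma length_power_antimono_exponent:
  assumes "0 \<le> t" "t \<le> 1" "0 \<le> s" "s \<le> s'"
  shows "length_power t s' \<le> length_power t s"
proof (cases "t = 0")
  case False
  then have "t powr s' \<le> t powr s" using assms by (intro powr_mono') auto
  then show ?thesis using False by (simp add: length_power_def ennreal_leI)
qed (use assms in \<open>auto simp: length_power_def\<close>)

lemma length_power_mono:
  assumes "0 \<le> t" "t \<le> t'" "0 \<le> s"
  shows "length_power t s \<le> length_power t' s"
proof (cases "t = 0")
  case True
  then show ?thesis using assms by (auto simp: length_power_def)
next
  case False
  then have "t powr s \<le> t' powr s" using assms by (intro powr_mono2) auto
  then show ?thesis using False assms by (simp add: length_power_def ennreal_leI)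
qed

lemma length_power_mult_le:
  assumes "0 \<le> t" "0 \<le> s"
  shows "length_power t s * ennreal t \<le> length_power t (s + 1)"
proof (cases "t = 0")
  case False
  then show ?thesis using assms
    by (simp add: length_power_def powr_add flip: ennreal_mult)
qed simp

text \<open>The hull from infimum to supremum stays inside \<open>[0,1]\<close>, where the growth
  bound on the marginal is available.\<close>

lemma bounded_real_obtain_Icc:
  fixes X :: "real set"
  assumes "X \<noteq> {}" "X \<subseteq> {0..1}" and diam: "\<And>x x'. x \<in> X \<Longrightarrow> x' \<in> X \<Longrightarrow> x - x' \<le> t"
  obtains a b where "X \<subseteq> {a..b}" "{a..b} \<subseteq> {0..1}" "a \<le> b" "b - a \<le> t"
proof
  have bdd: "bdd_above X" "bdd_below X"
    using bdd_above_mono[OF bdd_above_Icc assms(2)] bdd_below_mono[OF bdd_below_Icc assms(2)] .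
  show "X \<subseteq> {Inf X..Sup X}" using bdd by (auto intro: cInf_lower cSup_upper)
  have "0 \<le> Inf X" using assms by (intro cInf_greatest) auto
  moreover have "Sup X \<le> 1" using assms by (intro cSup_least) auto
  ultimately show "{Inf X..Sup X} \<subseteq> {0..1}" by auto
  show "Inf X \<le> Sup X" using assms(1) bdd by (rule cInf_le_cSup)
  have "x \<le> Inf X + t" if "x \<in> X" for x
  proof -
    have "x - t \<le> Inf X" using assms(1) diam[OF that] by (intro cInf_greatest) (auto simp: algebra_simps)
    then show ?thesis by simp
  qed
  then have "Sup X \<le> Inf X + t" using assms(1) by (intro cSup_least)
  then show "Sup X - Inf X \<le> t" by simp
qed

text \<open>Both projections of \<open>U \<inter> S\<close> lie in intervals of length at most the
  diameter \<open>t\<close> of \<open>U\<close>, so a box has mass at most \<open>C\<close> times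
  the power \<open>\<alpha> + 1\<close> of \<open>t\<close>; as \<open>t \<le> 1\<close>, the
  exponent may be lowered to \<open>s\<close>. The box also supplies measurability, which
  \<open>U\<close> may lack.\<close>

lemma cover_by_box:
  fixes M :: "real measure" and U S :: "(real \<times> real) set"
  assumes sets: "sets M = sets borel"
    and "0 \<le> \<alpha>"
    and bound: "\<And>I. is_interval I \<Longrightarrow> I \<subseteq> {0..1} \<Longrightarrow>
           emeasure M I \<le> ennreal C * length_power (measure lborel I) \<alpha>"
    and S: "S \<subseteq> {0..1} \<times> {0..1}" and U: "bounded U" "diameter U \<le> 1"
    and s: "0 \<le> s" "s \<le> \<alpha> + 1"
  shows "\<exists>B\<in>sets (M \<Otimes>\<^sub>M lborel). U \<inter> S \<subseteq> B \<and> emeasure (M \<Otimes>\<^sub>M lborel) B \<le>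
    ennreal C * (if U = {} then 0 else length_power (diameter U) s)"
proof (cases "U \<inter> S = {}")
  case True
  then show ?thesis by (intro bexI[of _ "{}"]) auto
next
  case False
  let ?t = "diameter U"
  have dist: "dist p q \<le> ?t" if "p \<in> U" "q \<in> U" for p q
    using diameter_bounded_bound[OF U(1) that] .
  have t0: "0 \<le> ?t" by (rule diameter_ge_0[OF U(1)])
  obtain a b where ab: "fst ` (U \<inter> S) \<subseteq> {a..b}" "{a..b} \<subseteq> {0..1}" "a \<le> b" "b - a \<le> ?t"
  proof (rule bounded_real_obtain_Icc[of "fst ` (U \<inter> S)" ?t])
    fix x x' assume "x \<in> fst ` (U \<inter> S)" "x' \<in> fst ` (U \<inter> S)"
    then obtain p q where "p \<in> U" "q \<in> U" "x = fst p" "x' = fst q" by auto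
    then show "x - x' \<le> ?t" using dist[of p q] dist_fst_le[of p q] by (simp add: dist_real_def)
  qed (use False S in auto)
  obtain a' b' where ab': "snd ` (U \<inter> S) \<subseteq> {a'..b'}" "a' \<le> b'" "b' - a' \<le> ?t"
  proof (rule bounded_real_obtain_Icc[of "snd ` (U \<inter> S)" ?t])
    fix x x' assume "x \<in> snd ` (U \<inter> S)" "x' \<in> snd ` (U \<inter> S)"
    then obtain p q where "p \<in> U" "q \<in> U" "x = snd p" "x' = snd q" by auto
    then show "x - x' \<le> ?t" using dist[of p q] dist_snd_le[of p q] by (simp add: dist_real_def)
  qed (use False S in auto)
  let ?B = "{a..b} \<times> {a'..b'}"
  have sub: "U \<inter> S \<subseteq> ?B"
  proof
    fix p assume "p \<in> U \<inter> S"
    then have "fst p \<in> fst ` (U \<inter> S)" "snd p \<in> snd ` (U \<inter> S)" by auto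
    then show "p \<in> ?B" using ab(1) ab'(1) by (auto simp: mem_Times_iff)
  qed
  have B: "?B \<in> sets (M \<Otimes>\<^sub>M lborel)" by (intro pair_measureI) (simp_all add: sets)
  have "emeasure (M \<Otimes>\<^sub>M lborel) ?B = emeasure M {a..b} * emeasure lborel {a'..b'}"
    by (intro lborel.emeasure_pair_measure_Times) (simp_all add: sets)
  also have "\<dots> \<le> (ennreal C * length_power ?t \<alpha>) * ennreal ?t"
  proof (rule mult_mono)
    have "emeasure M {a..b} \<le> ennreal C * length_power (b - a) \<alpha>"
      using bound[OF is_interval_cc ab(2)] ab(3) by simp
    also have "\<dots> \<le> ennreal C * length_power ?t \<alpha>"
      using ab assms(2) by (intro mult_left_mono length_power_mono) auto
    finally show "emeasure M {a..b} \<le> ennreal C * length_power ?t \<alpha>" .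
    show "emeasure lborel {a'..b'} \<le> ennreal ?t"
      using ab' by (simp add: ennreal_leI)
  qed auto
  also have "\<dots> \<le> ennreal C * length_power ?t (\<alpha> + 1)"
    unfolding mult.assoc using t0 assms(2) by (intro mult_left_mono length_power_mult_le) auto
  also have "\<dots> \<le> ennreal C * length_power ?t s"
    using t0 U s by (intro mult_left_mono length_power_antimono_exponent) auto
  finally have "emeasure (M \<Otimes>\<^sub>M lborel) ?B \<le> ennreal C * (if U = {} then 0 else length_power ?t s)"
    using False by auto
  with sub B show ?thesis by blast
qed

lemma pair_lborel_null_of_hausdorff_dim:
  fixes M :: "real measure" and S :: "(real \<times> real) set"
  assumes sets: "sets M = sets borel"
    and \<alpha>: "0 \<le> \<alpha>"
    and bound: "\<And>I. is_interval I \<Longrightarrow> I \<subseteq> {0..1} \<Longrightarrow>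
           emeasure M I \<le> ennreal C * length_power (measure lborel I) \<alpha>"
    and S: "S \<subseteq> {0..1} \<times> {0..1}" "S \<in> sets borel"
    and dim: "hausdorff_dim S < ereal (\<alpha> + 1)"
  shows "emeasure (M \<Otimes>\<^sub>M lborel) S = 0"
proof -
  obtain s where s: "0 \<le> s" "hausdorff_measure s S = 0" "s < \<alpha> + 1"
    using dim by (auto simp: hausdorff_dim_def INF_less_iff)
  \<comment> \<open>Scale 1 is fine enough: diameters at most 1 are what \<open>cover_by_box\<close>
    asks for, and the premeasure at that scale already vanishes.\<close>
  have "hausdorff_premeasure 1 s S \<le> hausdorff_measure s S"
    unfolding hausdorff_measure_def by (rule SUP_upper) simp
  then have pre: "hausdorff_premeasure 1 s S = 0" using s by simp
  have "emeasure (M \<Otimes>\<^sub>M lborel) S \<le> 0 + ennreal e" if e: "e > 0" for e :: real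
  proof -
    \<comment> \<open>The denominator is positive and dominates \<open>C\<close> whatever the sign
      of \<open>C\<close>.\<close>
    define \<delta> where "\<delta> = e / (\<bar>C\<bar> + 1)"
    have "\<delta> > 0" using e by (simp add: \<delta>_def)
    then have "hausdorff_premeasure 1 s S < ennreal \<delta>" using pre by simp
    then obtain U :: "nat \<Rightarrow> (real \<times> real) set" where U: "S \<subseteq> (\<Union>i. U i)" "\<And>i. bounded (U i)" "\<And>i. diameter (U i) \<le> 1"
      and sum: "(\<Sum>i. if U i = {} then 0 else length_power (diameter (U i)) s) < ennreal \<delta>"
      unfolding hausdorff_premeasure_def INF_less_iff by auto
    have "\<exists>B\<in>sets (M \<Otimes>\<^sub>M lborel). U i \<inter> S \<subseteq> B \<and> emeasure (M \<Otimes>\<^sub>M lborel) B \<le>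
        ennreal C * (if U i = {} then 0 else length_power (diameter (U i)) s)" for i
      by (rule cover_by_box[OF sets \<alpha> bound S(1)]) (use U s in auto)
    then obtain B where B: "\<And>i. B i \<in> sets (M \<Otimes>\<^sub>M lborel)" "\<And>i. U i \<inter> S \<subseteq> B i"
      "\<And>i. emeasure (M \<Otimes>\<^sub>M lborel) (B i) \<le>
        ennreal C * (if U i = {} then 0 else length_power (diameter (U i)) s)"
      by metis
    have "S \<subseteq> (\<Union>i. B i)" using U(1) B(2) by blast
    then have "emeasure (M \<Otimes>\<^sub>M lborel) S \<le> emeasure (M \<Otimes>\<^sub>M lborel) (\<Union>i. B i)"
      using B(1) by (intro emeasure_mono) auto
    also have "\<dots> \<le> (\<Sum>i. emeasure (M \<Otimes>\<^sub>M lborel) (B i))"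
      using B(1) by (intro emeasure_subadditive_countably) auto
    also have "\<dots> \<le> (\<Sum>i. ennreal C * (if U i = {} then 0 else length_power (diameter (U i)) s))"
      by (intro suminf_le B(3) summableI)
    also have "\<dots> = ennreal C * (\<Sum>i. if U i = {} then 0 else length_power (diameter (U i)) s)"
      by (rule ennreal_suminf_cmult)
    also have "\<dots> \<le> ennreal (\<bar>C\<bar> + 1) * ennreal \<delta>"
      using sum by (intro mult_mono ennreal_leI) auto
    also have "\<dots> = ennreal e"
    proof -
      have "0 \<le> \<bar>C\<bar> + 1" "0 \<le> \<delta>" "(\<bar>C\<bar> + 1) * \<delta> = e" using \<open>\<delta> > 0\<close> by (auto simp: \<delta>_def)
      then show ?thesis by (simp only: ennreal_mult[symmetric])
    qed
    finally show ?thesis by simp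
  qed
  then have "emeasure (M \<Otimes>\<^sub>M lborel) S \<le> 0" by (rule ennreal_le_epsilon)
  then show ?thesis by simp
qed

section \<open>Singularity of the slice measures\<close>

context square_disintegration
begin

text \<open>The slice of \<open>S\<close> itself is the carrier: by Fubini it is Lebesgue null for
  almost every \<open>x\<close>, and disintegrating the indicator of the complement of
  \<open>S\<close> shows that \<open>\<rho> x\<close> gives no mass to the complement of the
  slice.\<close>

lemma fibres_singular:
  assumes S: "S \<in> sets borel" "supported_on \<mu> S"
    and null: "emeasure (\<mu>\<^sub>1 \<Otimes>\<^sub>M lborel) S = 0"
  shows "AE x in \<mu>\<^sub>1. singular_wrt (\<rho> x) lborel"
proof -
  have Sp [measurable]: "S \<in> sets (borel \<Otimes>\<^sub>M borel)" using S(1) unfolding borel_prod .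
  have Sm: "S \<in> sets (\<mu>\<^sub>1 \<Otimes>\<^sub>M lborel)"
    using Sp by (simp cong: sets_pair_measure_cong add: marginal.sets_eq_borel)
  have "(\<integral>\<^sup>+x. emeasure lborel (Pair x -` S) \<partial>\<mu>\<^sub>1) = 0"
    using null by (simp add: lborel.emeasure_pair_measure_alt[OF Sm])
  then have slice: "AE x in \<mu>\<^sub>1. emeasure lborel (Pair x -` S) = 0"
    using lborel.measurable_emeasure_Pair[OF Sm] by (simp add: nn_integral_0_iff_AE)
  let ?h = "indicator (- S) :: real \<times> real \<Rightarrow> real"
  have cS: "- S \<in> sets \<mu>" using S(1) by (simp add: sets_eq_borel borel_comp)
  have sp: "space \<mu> = UNIV" using sets_eq_imp_space_eq[OF sets_eq_borel] by simp
  have m0: "measure \<mu> (- S) = 0"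
    using S(2) by (simp add: supported_on_def sp Compl_eq_Diff_UNIV measure_def)
  have ih: "integrable \<mu> ?h" using cS by (simp add: integrable_indicator_iff emeasure_eq_measure)
  note D = disintegration_real[OF ih]
  have h: "(LINT y|\<rho> x. ?h (x, y)) = measure (\<rho> x) (- (Pair x -` S))" if "x \<in> {0..<1}" for x
  proof -
    interpret F: circle_measure "\<rho> x" by (rule circle_measure_fibre) fact
    have "(LINT y|\<rho> x. ?h (x, y)) = (LINT y|\<rho> x. indicator (- (Pair x -` S)) y)"
      by (intro Bochner_Integration.integral_cong) (auto simp: indicator_def)
    then show ?thesis by simp
  qed
  have "integrable \<mu>\<^sub>1 (\<lambda>x. indicator {0..<1} x *\<^sub>R (LINT y|\<rho> x. ?h (x, y)))"
    using D(2) by (simp add: set_integrable_def)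
  moreover have "(LINT x|\<mu>\<^sub>1. indicator {0..<1} x *\<^sub>R (LINT y|\<rho> x. ?h (x, y))) = 0"
    using D(3) m0 cS sp by (simp add: set_lebesgue_integral_def)
  \<comment> \<open>Nonnegative slice masses with integral 0 vanish almost everywhere.\<close>
  moreover have "AE x in \<mu>\<^sub>1. 0 \<le> indicator {0..<1} x *\<^sub>R (LINT y|\<rho> x. ?h (x, y))"
    by (intro AE_I2) (auto simp: indicator_def intro!: Bochner_Integration.integral_nonneg)
  ultimately have "AE x in \<mu>\<^sub>1. indicator {0..<1} x *\<^sub>R (LINT y|\<rho> x. ?h (x, y)) = 0"
    by (simp only: integral_nonneg_eq_0_iff_AE)
  then show ?thesis
    using slice marginal.AE_unit_interval
  proof eventually_elim
    case (elim x)
    interpret F: circle_measure "\<rho> x" by (rule circle_measure_fibre) fact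
    let ?A = "Pair x -` S"
    have A: "?A \<in> sets borel"
      using sets_Pair1[OF Sp] by simp
    have "measure (\<rho> x) (- ?A) = 0" using elim(1,3) h by simp
    then have "emeasure (\<rho> x) (space (\<rho> x) - ?A) = 0"
      by (simp add: F.emeasure_eq_measure Compl_eq_Diff_UNIV)
    then show ?case
      using A elim(2) F.sets_eq_borel by (auto simp: singular_wrt_def supported_on_def)
  qed
qed

end

section \<open>Slice singularity and the double Fourier expansion, combined\<close>

theorem theorem7:
  fixes \<mu> :: "(real \<times> real) measure" and S :: "(real \<times> real) set"
    and C \<alpha> :: real and \<rho> :: "real \<Rightarrow> real measure"
  assumes "prob_space \<mu>" and "sets \<mu> = sets borel"
    and "supported_on \<mu> ({0..<1} \<times> {0..<1})"
    and "singular_wrt \<mu> lborel"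
    and "compact S" and "S \<subseteq> {0..1} \<times> {0..1}" and "supported_on \<mu> S"
    and "singular_wrt (x_marginal \<mu>) lborel"
    and "\<And>I. is_interval I \<Longrightarrow> I \<subseteq> {0..1} \<Longrightarrow>
           emeasure (x_marginal \<mu>) I \<le> ennreal C * length_power (measure lborel I) \<alpha>"
    and "hausdorff_dim S < ereal (\<alpha> + 1)"
    and "rokhlin_disintegration \<mu> \<rho>"
  shows "(AE x in x_marginal \<mu>. singular_wrt (\<rho> x) lborel) \<and>
    (\<forall>f\<in>L2 \<mu>. \<exists>(d :: nat \<Rightarrow> nat \<Rightarrow> complex) (g :: nat \<Rightarrow> real \<times> real \<Rightarrow> complex).
       (\<forall>n. L2_sums \<mu>
          (\<lambda>m (x, y). d n m * exp (2 * of_real pi * \<i> * of_real (real n * y + real m * x))) (g n)) \<and>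
       L2_sums \<mu> g f)"
proof -
  interpret prob_space \<mu> by fact
  interpret square_disintegration \<mu> \<rho> by unfold_locales fact+
  have S: "S \<in> sets borel" using \<open>compact S\<close> by (rule borel_compact)
  have "emeasure (\<mu>\<^sub>1 \<Otimes>\<^sub>M lborel) S = 0"
  proof (cases "0 \<le> \<alpha>")
    case True
    show ?thesis
      by (rule pair_lborel_null_of_hausdorff_dim[OF marginal.sets_eq_borel True _ \<open>S \<subseteq> _\<close> S assms(10)])
        (rule assms(9))
  next
    case False
    \<comment> \<open>The trivial bound by \<open>1 = \<bar>I\<bar>\<^sup>0\<close> replaces the given one, since \<open>\<alpha> + 1 < 0 + 1\<close>.\<close>
    have "hausdorff_dim S < ereal (0 + 1)"
      using assms(10) by (rule less_trans) (use False in simp)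
    then show ?thesis
      by (intro pair_lborel_null_of_hausdorff_dim[OF marginal.sets_eq_borel order_refl _ \<open>S \<subseteq> _\<close> S, of 1])
        (simp_all add: length_power_def marginal.emeasure_le_1)
  qed
  then have sing: "AE x in \<mu>\<^sub>1. singular_wrt (\<rho> x) lborel"
    by (rule fibres_singular[OF S assms(7)])
  then show ?thesis
    using fourier_expansion[OF _ assms(8) sing] by blast
qed

end
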